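(* Let $E$ be a Banach space over a valued field $(\mathbb{K},|.|)$ and $d_\infty\colon BC(E,E)^2\to[0,\infty[$, $d_\infty(h_1,h_2):=\|h_1-h_2\|_\infty$ be the supremum metric. Let $A\colon E\to E$ be a hyperbolic automorphism, $E=E_{\rm s}\oplus E_{\rm u}$ the associated decomposition, $\|.\|$ a norm on $E$ adapted to $A$, $A_1:=A|_{E_{\rm s}}\colon E_{\rm s}\to E_{\rm s}$ and $A_2:=A|_{E_{\rm u}}\colon E_{\rm u}\to E_{\rm u}$. Let $\alpha\in\,]0,1[$ and $\varepsilon,\delta>0$ be such that \[ \delta<\|A^{-1}\|^{-1},\qquad \|A_2^{-1}\|(1+\delta)<1,\qquad \|A_1\|+\delta<1, \] \[ 2\|A_2^{-1}\|\delta+\varepsilon\|A_2^{-1}\|(\|A\|+\delta)^\alpha+\|A_2^{-1}\|\max\{\delta(1+\varepsilon),2\delta\}\le\varepsilon, \] and \[ \frac{\varepsilon\|A_1\|}{(\|A^{-1}\|^{-1}-\delta)^\alpha}+\max\Big\{\frac{\delta}{\|A^{-1}\|^{-1}-\delta},2\delta\Big\}+\frac{\max\{\delta(1+\varepsilon),2\delta\}}{(\|A^{-1}\|^{-1}-\delta)^\alpha}\le\varepsilon . \] Let $\Omega$ be the set of all bounded, Lipschitz maps $g\colon E\to E$ such that $\max\{\|g\|_\infty,\operatorname{Lip}(g)\}\le\delta$. For $g\in\Omega$, let $v_g,w_g\colon E\to E$ be the bounded continuous maps determined by \[ (A+g)\circ(\mathrm{id}_E+v_g)=(\mathrm{id}_E+v_g)\circ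 A \] and $w_g:=(\mathrm{id}_E+v_g)^{-1}-\mathrm{id}_E$. Set $\sigma(g):=v_g$, $\tau(g):=w_g$. Then $\sigma$ is Lipschitz as a map from $(\Omega,d_\infty)$ to $(BC(E,E),d_\infty)$, and $\tau\colon(\Omega,d_\infty)\to(BC(E,E),d_\infty)$ is H\"older of exponent $\alpha$.
   Context: A valued field $(\mathbb{K},|.|)$ is a field with an absolute value $|.|$ defining a non-discrete topology. A Banach space over it is a complete normed space, where $\|\lambda x\|=|\lambda|\,\|x\|$. Hyperbolicity: an automorphism $A\colon E\to E$ of topological vector spaces is hyperbolic if there exist $A$-invariant vector subspaces $E_{\rm s},E_{\rm u}$ with $E=E_{\rm s}\oplus E_{\rm u}$, and a norm $\|.\|$ on $E$ defining its topology (called adapted to $A$), such that $\|x+y\|=\max\{\|x\|,\|y\|\}$ for all $x\in E_{\rm s}$, $y\in E_{\rm u}$, and $\|A|_{E_{\rm s}}\|<1$, $\|A^{-1}|_{E_{\rm u}}\|<1$ for the operator norms with respect to $\|.\|$. All norms, operator norms, and Lipschitz constants are formed using the adapted norm $\|.\|$. $BC(E,E)$ is the space of bounded continuous functions $E\to E$, with $\|f\|_\infty:=\sup_{x}\|f(x)\|$; $\operatorname{Lip}(f)$ is the smallest Lipschitz constant of $f$. The operator norm is $\|B\|:=\sup\{\|Bx\|/\|x\|\colon 0\ne x\}$. A map $f\colon(X,d_X)\to(Y,d_Y)$ is H\"older of exponent $\alpha>0$ if there is $L\in[0,\infty[$ with $d_Y(f(x),f(y))\le L\,d_X(x,y)^\alpha$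 for all $x,y$. (Under the given hypotheses $v_g$ exists and is unique among bounded continuous maps, and $\mathrm{id}_E+v_g$ is a homeomorphism of $E$.) *)

theory Defs
  imports "HOL-Analysis.Analysis"
begin

section \<open>Valued fields and Banach spaces over them\<close>

text \<open>Norms are explicit functions rather than type class operations, because the scalar field is
  an arbitrary valued field and because two norms on the same space (the given one and an adapted
  one) have to be considered at once.\<close>

definition norm_metric :: "('a::ab_group_add \<Rightarrow> real) \<Rightarrow> 'a metric"
  where "norm_metric N = metric (UNIV, \<lambda>x y. N (x - y))"

definition absolute_value :: "('k::field \<Rightarrow> real) \<Rightarrow> bool"
  where "absolute_value v \<longleftrightarrow>
    (\<forall>x. 0 \<le> v x) \<and> (\<forall>x. v x = 0 \<longleftrightarrow> x = 0) \<and>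
    (\<forall>x y. v (x * y) = v x * v y) \<and> (\<forall>x y. v (x + y) \<le> v x + v y)"

definition valued_field :: "('k::field \<Rightarrow> real) \<Rightarrow> bool"
  where "valued_field v \<longleftrightarrow>
    absolute_value v \<and> mtopology_of (norm_metric v) \<noteq> discrete_topology UNIV"

definition norm_over ::
    "('k::field \<Rightarrow> real) \<Rightarrow> ('k \<Rightarrow> 'e::ab_group_add \<Rightarrow> 'e) \<Rightarrow> ('e \<Rightarrow> real) \<Rightarrow> bool"
  where "norm_over v smul N \<longleftrightarrow>
    (\<forall>x. 0 \<le> N x) \<and> (\<forall>x. N x = 0 \<longleftrightarrow> x = 0) \<and>
    (\<forall>c x. N (smul c x) = v c * N x) \<and> (\<forall>x y. N (x + y) \<le> N x + N y)"

definition banach_space_over ::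
    "('k::field \<Rightarrow> real) \<Rightarrow> ('k \<Rightarrow> 'e::ab_group_add \<Rightarrow> 'e) \<Rightarrow> ('e \<Rightarrow> real) \<Rightarrow> bool"
  where "banach_space_over v smul N \<longleftrightarrow>
    vector_space smul \<and> norm_over v smul N \<and> mcomplete_of (norm_metric N)"

section \<open>Operator norms and hyperbolic automorphisms\<close>

text \<open>Operator norm of the restriction of \<open>f\<close> to \<open>S\<close>. In the intended uses \<open>S\<close> is a vector
  subspace. The vector \<open>0\<close> is not excluded from the supremum: its quotient is \<open>N (f 0) / 0 = 0\<close>,
  which changes nothing, except that it makes the operator norm on the zero space equal to \<open>0\<close>.\<close>

definition op_norm :: "('e::ab_group_add \<Rightarrow> real) \<Rightarrow> 'e set \<Rightarrow> ('e \<Rightarrow> 'e) \<Rightarrow> real"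
  where "op_norm N S f = (SUP x\<in>S. N (f x) / N x)"

definition tvs_automorphism ::
    "('k::field \<Rightarrow> 'e::ab_group_add \<Rightarrow> 'e) \<Rightarrow> 'e topology \<Rightarrow> ('e \<Rightarrow> 'e) \<Rightarrow> bool"
  where "tvs_automorphism smul T A \<longleftrightarrow>
    Vector_Spaces.linear smul smul A \<and> homeomorphic_map T T A"

definition adapted_norm ::
    "('k::field \<Rightarrow> real) \<Rightarrow> ('k \<Rightarrow> 'e::ab_group_add \<Rightarrow> 'e) \<Rightarrow> 'e topology \<Rightarrow>
     ('e \<Rightarrow> 'e) \<Rightarrow> 'e set \<Rightarrow> 'e set \<Rightarrow> ('e \<Rightarrow> real) \<Rightarrow> bool"
  where "adapted_norm v smul T A Es Eu N \<longleftrightarrow>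
    module.subspace smul Es \<and> module.subspace smul Eu \<and>
    A ` Es \<subseteq> Es \<and> A ` Eu \<subseteq> Eu \<and>
    Es \<inter> Eu = {0} \<and> (\<forall>z. \<exists>x\<in>Es. \<exists>y\<in>Eu. z = x + y) \<and>
    norm_over v smul N \<and> mtopology_of (norm_metric N) = T \<and>
    (\<forall>x\<in>Es. \<forall>y\<in>Eu. N (x + y) = max (N x) (N y)) \<and>
    op_norm N Es A < 1 \<and> op_norm N Eu (inv A) < 1"

definition hyperbolic_automorphism ::
    "('k::field \<Rightarrow> real) \<Rightarrow> ('k \<Rightarrow> 'e::ab_group_add \<Rightarrow> 'e) \<Rightarrow> 'e topology \<Rightarrow> ('e \<Rightarrow> 'e) \<Rightarrow> bool"
  where "hyperbolic_automorphism v smul T A \<longleftrightarrow>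
    tvs_automorphism smul T A \<and> (\<exists>Es Eu N. adapted_norm v smul T A Es Eu N)"

section \<open>Spaces of maps\<close>

definition sup_norm :: "('e::ab_group_add \<Rightarrow> real) \<Rightarrow> ('e \<Rightarrow> 'e) \<Rightarrow> real"
  where "sup_norm N f = (SUP x. N (f x))"

definition lip_const :: "('e::ab_group_add \<Rightarrow> real) \<Rightarrow> ('e \<Rightarrow> 'e) \<Rightarrow> real"
  where "lip_const N f = Inf {L. 0 \<le> L \<and> (\<forall>x y. N (f x - f y) \<le> L * N (x - y))}"

text \<open>\<open>BC(E,E)\<close> with the supremum metric; see \<open>mspace_bc_space\<close> and \<open>mdist_bc_space\<close> below.\<close>

definition bc_space :: "('e::ab_group_add \<Rightarrow> real) \<Rightarrow> ('e \<Rightarrow> 'e) metric"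
  where "bc_space N = cfunspace (mtopology_of (norm_metric N)) (norm_metric N)"

definition small_lipschitz_maps :: "('e::ab_group_add \<Rightarrow> real) \<Rightarrow> real \<Rightarrow> ('e \<Rightarrow> 'e) set"
  where "small_lipschitz_maps N \<delta> =
    {g. bdd_above (range (\<lambda>x. N (g x))) \<and>
        Lipschitz_continuous_map (norm_metric N) (norm_metric N) g \<and>
        max (sup_norm N g) (lip_const N g) \<le> \<delta>}"

definition Holder_map :: "real \<Rightarrow> 'a metric \<Rightarrow> 'b metric \<Rightarrow> ('a \<Rightarrow> 'b) \<Rightarrow> bool"
  where "Holder_map \<alpha> m1 m2 f \<longleftrightarrow>
    f \<in> mspace m1 \<rightarrow> mspace m2 \<and>
    (\<exists>L\<ge>0. \<forall>x\<in>mspace m1. \<forall>y\<in>mspace m1. mdist m2 (f x) (f y) \<le> L * mdist m1 x y powr \<alpha>)"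

section \<open>The conjugating maps\<close>

text \<open>\<open>conj_disp N A g\<close> is the map $v_g$ and \<open>conj_disp_inv N A g\<close> is the map $w_g$.
  The description is proper, and \<open>inv\<close> is a genuine inverse, when $v_g$ exists and is unique and
  $\mathrm{id}+v_g$ is bijective, as is the case for hyperbolic \<open>A\<close> and sufficiently small \<open>g\<close>.\<close>

definition conj_disp :: "('e::ab_group_add \<Rightarrow> real) \<Rightarrow> ('e \<Rightarrow> 'e) \<Rightarrow> ('e \<Rightarrow> 'e) \<Rightarrow> 'e \<Rightarrow> 'e"
  where "conj_disp N A g =
    (THE w. w \<in> mspace (bc_space N) \<and>
      (\<lambda>x. A x + g x) \<circ> (\<lambda>x. x + w x) = (\<lambda>x. x + w x) \<circ> A)"

definition conj_disp_inv :: "('e::ab_group_add \<Rightarrow> real) \<Rightarrow> ('e \<Rightarrow> 'e) \<Rightarrow> ('e \<Rightarrow> 'e) \<Rightarrow> 'e \<Rightarrow> 'e"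
  where "conj_disp_inv N A g = (\<lambda>x. inv (\<lambda>y. y + conj_disp N A g y) x - x)"

section \<open>Unfolding the metric spaces\<close>

lemma absolute_value_norm_over: "absolute_value v \<longleftrightarrow> norm_over v (*) v"
  by (auto simp: absolute_value_def norm_over_def)

context
  fixes v :: "'k::field \<Rightarrow> real" and smul :: "'k \<Rightarrow> 'e::ab_group_add \<Rightarrow> 'e" and N :: "'e \<Rightarrow> real"
  assumes av: "absolute_value v" and vs: "vector_space smul" and no: "norm_over v smul N"
begin

lemma norm_over_uminus: "N (- x) = N x"
proof -
  interpret vector_space smul by (rule vs)
  have "v (- 1) * v (- 1) = v 1" "v 1 * v 1 = v 1" "v 1 \<noteq> 0" "v (- 1) \<ge> 0"
    using av unfolding absolute_value_def by (metis mult_minus1 minus_minus mult_1 one_neq_zero)+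
  then have "v (- 1) = 1"
    by (metis mult_cancel_left1 power2_eq_square power2_eq_1_iff neg_0_le_iff_le not_one_le_zero)
  then have "N (smul (- 1) x) = N x"
    using no unfolding norm_over_def by (metis mult_1)
  then show ?thesis by simp
qed

lemma Metric_space_norm_over: "Metric_space UNIV (\<lambda>x y. N (x - y))"
proof
  fix x y z :: 'e
  show "0 \<le> N (x - y)" "N (x - y) = 0 \<longleftrightarrow> x = y"
    using no by (simp_all add: norm_over_def)
  show "N (x - y) = N (y - x)"
    by (metis norm_over_uminus minus_diff_eq)
  have "N ((x - y) + (y - z)) \<le> N (x - y) + N (y - z)"
    using no unfolding norm_over_def by blast
  then show "N (x - z) \<le> N (x - y) + N (y - z)" by simp
qed

lemma mspace_norm_metric: "mspace (norm_metric N) = UNIV"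
  and mdist_norm_metric: "mdist (norm_metric N) = (\<lambda>x y. N (x - y))"
  by (simp_all add: norm_metric_def Metric_space.mspace_metric Metric_space.mdist_metric
      Metric_space_norm_over)

lemma mspace_bc_space:
  "f \<in> mspace (bc_space N) \<longleftrightarrow>
    bdd_above (range (\<lambda>x. N (f x))) \<and>
    continuous_map (mtopology_of (norm_metric N)) (mtopology_of (norm_metric N)) f"
proof -
  interpret Metric_space UNIV "\<lambda>x y. N (x - y)" by (rule Metric_space_norm_over)
  have "mbounded (range f) \<longleftrightarrow> bdd_above (range (\<lambda>x. N (f x)))"
  proof
    assume "mbounded (range f)"
    then obtain c B where "range f \<subseteq> mcball c B" by (auto simp: mbounded_def)
    then have B: "N (c - f x) \<le> B" for x by (metis in_mcball rangeI subsetD)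
    have "N (f x) \<le> N c + B" for x
    proof -
      have "N (c + (f x - c)) \<le> N c + N (f x - c)" using no unfolding norm_over_def by blast
      moreover have "N (f x - c) = N (c - f x)" by (rule commute)
      ultimately show ?thesis using B[of x] by simp
    qed
    then show "bdd_above (range (\<lambda>x. N (f x)))" by (auto simp: bdd_above_def)
  next
    assume "bdd_above (range (\<lambda>x. N (f x)))"
    then obtain B where B: "N (f x) \<le> B" for x by (auto simp: bdd_above_def)
    have "range f \<subseteq> mcball 0 B"
      using B by (auto simp: norm_over_uminus)
    then show "mbounded (range f)" by (auto simp: mbounded_def)
  qed
  then show ?thesis
    by (simp add: bc_space_def mspace_norm_metric mdist_norm_metric)
qed

lemma mdist_bc_space:
  assumes "f \<in> mspace (bc_space N)" "g \<in> mspace (bc_space N)"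
  shows "mdist (bc_space N) f g = sup_norm N (\<lambda>x. f x - g x)"
proof -
  interpret Metric_space UNIV "\<lambda>x y. N (x - y)" by (rule Metric_space_norm_over)
  have "f \<in> fspace UNIV" "g \<in> fspace UNIV"
    using assms by (auto simp: bc_space_def mspace_norm_metric mdist_norm_metric fspace_def)
  then show ?thesis
    by (simp add: bc_space_def cfunspace_def mspace_norm_metric mdist_norm_metric fdist_def
        sup_norm_def)
qed

lemma small_lipschitz_maps_subset: "small_lipschitz_maps N \<delta> \<subseteq> mspace (bc_space N)"
  by (auto simp: small_lipschitz_maps_def mspace_bc_space Lipschitz_continuous_imp_continuous_map)

end

end

theory Submission
  imports Defs
begin

text \<open>Splitting along \<open>E\<^sub>s \<oplus> E\<^sub>u\<close> turns each functional equation involved into a contraction of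
  \<open>BC(E,E)\<close>, which yields \<open>v\<^sub>g\<close> and its Lipschitz dependence on \<open>g\<close>. The map \<open>w\<^sub>g\<close> solves the
  equation \<open>w \<circ> (A + g) = A \<circ> w - g\<close>, which is affine in \<open>w\<close>; the two numerical hypotheses say
  that the corresponding contraction preserves the maps that are Hoelder with constant \<open>\<epsilon>\<close>, so \<open>w\<^sub>g\<close>
  is one of them. The Hoelder dependence of \<open>w\<^sub>g\<close> on \<open>g\<close> follows, since \<open>id + w\<^sub>g\<close> is the inverse of
  \<open>id + v\<^sub>g\<close>.\<close>

text \<open>Neither direction of iteration is contracting on the whole space, so the stable and
  unstable components are estimated separately. The maximum form of the adapted norm lets the two
  bounds be combined without a loss, at the common rate max(|A_1| + \<delta>, |A_2^{-1}|(1 +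
  \<delta>)). Regularity is lost for \<open>w\<^sub>g\<close> because \<open>g\<close> sits inside
  the argument of \<open>w\<close> in its equation: the equation relates differences of
  \<open>w\<close> at two points to differences at their images or preimages under A + g, and either
  map may expand distances. With an exponent \<alpha> < 1 these expansions enter only as (|A| +
  \<delta>)^\<alpha> and (|A^{-1}|^{-1} - \<delta>)^{-\<alpha>}, which the hypotheses keep under
  control. A second obstacle is that completeness is given for one norm, while all contractions are
  measured in another. Over a general valued field, passing between the two uses that the absolute
  value is not discrete.\<close>

text \<open>Uniform estimates for solutions of contractive equations are obtained without closed
  invariant subsets of the function space, by improving an a priori bound repeatedly.\<close>

lemma nonpos_of_contracting_bounds:
  fixes f :: "'a \<Rightarrow> real"
  assumes bdd: "\<And>x. f x \<le> C"
    and step: "\<And>B x. 0 \<le> B \<Longrightarrow> (\<And>y. f y \<le> B) \<Longrightarrow> f x \<le> \<kappa> * B"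
    and \<kappa>: "0 \<le> \<kappa>" "\<kappa> < 1"
  shows "f x \<le> 0"
proof -
  have "f y \<le> \<kappa> ^ n * max C 0" for n y
  proof (induction n arbitrary: y)
    case 0
    show ?case using bdd[of y] by simp
  next
    case (Suc n)
    show ?case
      using step[OF _ Suc, of y] \<kappa>(1) by (simp add: mult.assoc)
  qed
  moreover have "(\<lambda>n. \<kappa> ^ n * max C 0) \<longlonglongrightarrow> 0"
    using \<kappa> by (intro tendsto_mult_left_zero LIMSEQ_realpow_zero)
  ultimately show ?thesis
    by (intro LIMSEQ_le_const) auto
qed

section \<open>Normed spaces over a valued field\<close>

locale normed_space_over =
  fixes v :: "'k::field \<Rightarrow> real"
    and smul :: "'k \<Rightarrow> 'e::ab_group_add \<Rightarrow> 'e"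
    and N :: "'e \<Rightarrow> real"
  assumes av: "absolute_value v" and vs: "vector_space smul" and no: "norm_over v smul N"
begin

lemma N_nonneg [simp]: "0 \<le> N x"
  and N_eq_0_iff [simp]: "N x = 0 \<longleftrightarrow> x = 0"
  and N_triangle: "N (x + y) \<le> N x + N y"
  and N_smul: "N (smul c x) = v c * N x"
  using no by (auto simp: norm_over_def)

lemma N_zero [simp]: "N 0 = 0"
  by simp

lemma N_le_0_iff [simp]: "N x \<le> 0 \<longleftrightarrow> x = 0"
  using N_nonneg[of x] N_eq_0_iff[of x] by linarith

lemma N_uminus [simp]: "N (- x) = N x"
  by (rule norm_over_uminus[OF av vs no])

lemma N_triangle_diff: "N (x - y) \<le> N x + N y"
  using N_triangle[of x "- y"] by simp

sublocale Metric_space UNIV "\<lambda>x y. N (x - y)"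
  by (rule Metric_space_norm_over[OF av vs no])

lemma mtopology_of_norm_metric: "mtopology_of (norm_metric N) = mtopology"
  by (simp add: norm_metric_def)

lemma mcomplete_of_norm_metric: "mcomplete_of (norm_metric N) = mcomplete"
  by (simp add: norm_metric_def)

section \<open>Continuous maps and bounded continuous maps\<close>

abbreviation cont :: "('e \<Rightarrow> 'e) \<Rightarrow> bool"
  where "cont \<equiv> continuous_map mtopology mtopology"

abbreviation BC :: "('e \<Rightarrow> 'e) set"
  where "BC \<equiv> mspace (bc_space N)"

lemma cont_iff: "cont f \<longleftrightarrow> (\<forall>a. \<forall>\<epsilon>>0. \<exists>\<delta>>0. \<forall>x. N (a - x) < \<delta> \<longrightarrow> N (f a - f x) < \<epsilon>)"
  by (simp add: metric_continuous_map[OF Metric_space_axioms])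

lemma cont_Lipschitz:
  assumes "0 \<le> K" "\<And>x y. N (f x - f y) \<le> K * N (x - y)"
  shows "cont f"
  unfolding cont_iff
proof (intro allI impI)
  fix a \<epsilon> assume "\<epsilon> > (0::real)"
  \<comment> \<open>The slope \<open>K + 1\<close> in place of \<open>K\<close> keeps the division
    legitimate when \<open>K\<close> is 0.\<close>
  have "N (f a - f x) < \<epsilon>" if "N (a - x) < \<epsilon> / (K + 1)" for x
  proof -
    have "N (f a - f x) \<le> (K + 1) * N (a - x)"
      using assms(2)[of a x] by (simp add: distrib_right add_increasing2)
    also have "\<dots> < \<epsilon>" using that assms(1) by (simp add: field_simps)
    finally show ?thesis .
  qed
  then show "\<exists>\<delta>>0. \<forall>x. N (a - x) < \<delta> \<longrightarrow> N (f a - f x) < \<epsilon>"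
    using \<open>\<epsilon> > 0\<close> assms(1) by (intro exI[of _ "\<epsilon> / (K + 1)"]) auto
qed

lemma cont_add:
  assumes "cont f" "cont g"
  shows "cont (\<lambda>x. f x + g x)"
  unfolding cont_iff
proof (intro allI impI)
  fix a \<epsilon> assume "\<epsilon> > (0::real)"
  then have "\<epsilon> / 2 > 0" by simp
  then have "\<exists>d>0. \<forall>x. N (a - x) < d \<longrightarrow> N (f a - f x) < \<epsilon> / 2"
    "\<exists>d>0. \<forall>x. N (a - x) < d \<longrightarrow> N (g a - g x) < \<epsilon> / 2"
    using assms unfolding cont_iff by blast+
  then obtain d1 d2 where d: "d1 > 0" "\<And>x. N (a - x) < d1 \<Longrightarrow> N (f a - f x) < \<epsilon> / 2"
      "d2 > 0" "\<And>x. N (a - x) < d2 \<Longrightarrow> N (g a - g x) < \<epsilon> / 2"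
    by blast
  have "N (f a + g a - (f x + g x)) < \<epsilon>" if "N (a - x) < min d1 d2" for x
    using N_triangle[of "f a - f x" "g a - g x"] d(2,4)[of x] that by (simp add: algebra_simps)
  then show "\<exists>\<delta>>0. \<forall>x. N (a - x) < \<delta> \<longrightarrow> N (f a + g a - (f x + g x)) < \<epsilon>"
    using d(1,3) by (intro exI[of _ "min d1 d2"]) auto
qed

lemma cont_uminus: "cont f \<Longrightarrow> cont (\<lambda>x. - f x)"
  by (simp add: cont_iff commute)

lemma cont_diff: "cont f \<Longrightarrow> cont g \<Longrightarrow> cont (\<lambda>x. f x - g x)"
  using cont_add[OF _ cont_uminus, of f g] by simp

lemma cont_comp: "cont f \<Longrightarrow> cont g \<Longrightarrow> cont (\<lambda>x. f (g x))"
  using continuous_map_compose[of _ _ g _ f] by (simp add: comp_def)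

lemma cont_id: "cont (\<lambda>x. x)"
  using continuous_map_id[of mtopology] by (simp add: id_def)

lemma BC_iff: "f \<in> BC \<longleftrightarrow> (\<exists>C. \<forall>x. N (f x) \<le> C) \<and> cont f"
  by (auto simp: mspace_bc_space[OF av vs no] mtopology_of_norm_metric bdd_above_def)

lemma BC_cont: "f \<in> BC \<Longrightarrow> cont f"
  by (simp add: BC_iff)

lemma BC_bounded:
  assumes "f \<in> BC"
  obtains C where "0 \<le> C" "\<And>x. N (f x) \<le> C"
  using assms N_nonneg unfolding BC_iff by (meson order_trans)

lemma BC_I: "(\<And>x. N (f x) \<le> C) \<Longrightarrow> cont f \<Longrightarrow> f \<in> BC"
  by (auto simp: BC_iff)

lemma BC_diff:
  assumes "f \<in> BC" "g \<in> BC"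
  shows "(\<lambda>x. f x - g x) \<in> BC"
proof -
  obtain C D where "\<And>x. N (f x) \<le> C" "\<And>x. N (g x) \<le> D"
    using assms BC_bounded by metis
  then have "N (f x - g x) \<le> C + D" for x
    using N_triangle_diff[of "f x" "g x"] by (meson add_mono order_trans)
  then show ?thesis
    using assms by (intro BC_I cont_diff) (auto simp: BC_iff)
qed

lemma N_le_mdist_BC:
  assumes "f \<in> BC" "g \<in> BC"
  shows "N (f x - g x) \<le> mdist (bc_space N) f g"
proof -
  have "bdd_above (range (\<lambda>x. N (f x - g x)))"
    using BC_diff[OF assms] by (simp add: mspace_bc_space[OF av vs no])
  then show ?thesis
    unfolding mdist_bc_space[OF av vs no assms] sup_norm_def by (rule cSUP_upper[rotated]) simp
qed

lemma mdist_BC_le: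
  assumes "f \<in> BC" "g \<in> BC" "\<And>x. N (f x - g x) \<le> C"
  shows "mdist (bc_space N) f g \<le> C"
  unfolding mdist_bc_space[OF av vs no assms(1,2)] sup_norm_def
  using assms(3) by (intro cSUP_least) auto

lemma mcomplete_of_bc_space: "mcomplete \<Longrightarrow> mcomplete_of (bc_space N)"
  using mcomplete_cfunspace[of mtopology]
  by (simp add: bc_space_def norm_metric_def Self_def)

lemma small_lipschitz_maps_iff:
  assumes "0 \<le> \<delta>"
  shows "g \<in> small_lipschitz_maps N \<delta> \<longleftrightarrow>
    (\<forall>x. N (g x) \<le> \<delta>) \<and> (\<forall>x y. N (g x - g y) \<le> \<delta> * N (x - y))"
proof
  let ?S = "{L. 0 \<le> L \<and> (\<forall>x y. N (g x - g y) \<le> L * N (x - y))}"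
  have bddS: "bdd_below ?S" by (auto simp: bdd_below_def)
  {
    assume g: "g \<in> small_lipschitz_maps N \<delta>"
    then have bdd: "bdd_above (range (\<lambda>x. N (g x)))" and s: "sup_norm N g \<le> \<delta>"
      and l: "lip_const N g \<le> \<delta>"
      and lip: "Lipschitz_continuous_map (norm_metric N) (norm_metric N) g"
      by (auto simp: small_lipschitz_maps_def)
    obtain L where "L > 0" "\<And>x y. N (g x - g y) \<le> L * N (x - y)"
      using lip by (auto simp: Lipschitz_continuous_map_pos mspace_norm_metric[OF av vs no]
          mdist_norm_metric[OF av vs no])
    then have "L \<in> ?S" by simp
    \<comment> \<open>Only for a nonempty set of Lipschitz constants does a bound on the infimum
      \<open>lip_const\<close> carry information; the qualitative Lipschitz condition in
      \<open>small_lipschitz_maps\<close> provides a member.\<close>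
    then have ne: "?S \<noteq> {}" by blast
    have "N (g x - g y) \<le> \<delta> * N (x - y)" for x y
    proof (cases "x = y")
      case False
      then have pos: "N (x - y) > 0" by (simp add: order_less_le)
      have "N (g x - g y) / N (x - y) \<le> Inf ?S"
        using ne pos by (intro cInf_greatest) (auto simp: divide_le_eq)
      also have "\<dots> \<le> \<delta>" using l by (simp add: lip_const_def)
      finally show ?thesis using pos by (simp add: divide_le_eq)
    qed simp
    moreover have "N (g x) \<le> \<delta>" for x
      using cSUP_upper[OF _ bdd, of x] s by (simp add: sup_norm_def)
    ultimately show "(\<forall>x. N (g x) \<le> \<delta>) \<and> (\<forall>x y. N (g x - g y) \<le> \<delta> * N (x - y))"
      by blast
  }
  {
    assume g: "(\<forall>x. N (g x) \<le> \<delta>) \<and> (\<forall>x y. N (g x - g y) \<le> \<delta> * N (x - y))"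
    then have "sup_norm N g \<le> \<delta>" by (auto simp: sup_norm_def intro: cSUP_least)
    moreover have "lip_const N g \<le> \<delta>"
      unfolding lip_const_def using g assms by (intro cInf_lower bddS) auto
    ultimately show "g \<in> small_lipschitz_maps N \<delta>"
      using g by (auto simp: small_lipschitz_maps_def bdd_above_def Lipschitz_continuous_map_def
          mspace_norm_metric[OF av vs no] mdist_norm_metric[OF av vs no])
  }
qed

lemma small_lipschitz_mapsD:
  assumes "g \<in> small_lipschitz_maps N \<delta>" "0 \<le> \<delta>"
  shows "N (g x) \<le> \<delta>" "N (g x - g y) \<le> \<delta> * N (x - y)" "cont g"
  using assms cont_Lipschitz by (auto simp: small_lipschitz_maps_iff)

end

section \<open>Bounded linear maps and equivalent norms over a valued field\<close>

text \<open>Otherwise every nonzero scalar would have absolute value at least 1, so open unit balls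
  would be singletons and the topology discrete.\<close>

lemma valued_field_obtain_small:
  assumes "valued_field v"
  obtains c where "0 < v c" "v c < 1"
proof -
  have av: "absolute_value v" and nd: "mtopology_of (norm_metric v) \<noteq> discrete_topology UNIV"
    using assms by (auto simp: valued_field_def)
  interpret K: normed_space_over v "(*)" v
    using av by unfold_locales (auto simp: absolute_value_norm_over algebra_simps)
  have "\<exists>c. 0 < v c \<and> v c < 1"
  proof (rule ccontr)
    assume "\<not> ?thesis"
    then have "v c \<ge> 1" if "c \<noteq> 0" for c
      using that K.N_nonneg[of c] by (metis K.N_eq_0_iff order_less_le not_less)
    then have "K.mball x 1 = {x}" for x
      by (auto simp: K.mball_def) (metis K.N_eq_0_iff eq_iff_diff_eq_0 not_less)
    then have "openin K.mtopology {x}" for x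
      using K.openin_mball by metis
    then have "K.mtopology = discrete_topology UNIV"
      by (metis K.topspace_mtopology discrete_topology_unique)
    then show False using nd K.mtopology_of_norm_metric by simp
  qed
  then show ?thesis using that by blast
qed

text \<open>Rescaling by powers of a scalar of absolute value in \<open>(0,1)\<close> replaces the rescaling by real
  scalars that is available over the reals.\<close>

lemma linear_continuous_imp_bounded:
  assumes vf: "valued_field v" and vs: "vector_space smul"
    and n1: "norm_over v smul N1" and n2: "norm_over v smul N2"
    and lin: "\<And>x y. f (x + y) = f x + f y" "\<And>c x. f (smul c x) = smul c (f x)"
    and cont: "continuous_map (mtopology_of (norm_metric N1)) (mtopology_of (norm_metric N2)) f"
  obtains K where "0 \<le> K" "\<And>x. N2 (f x) \<le> K * N1 x"
proof -
  have av: "absolute_value v" using vf by (simp add: valued_field_def)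
  interpret V: vector_space smul by (rule vs)
  interpret E1: normed_space_over v smul N1 using av vs n1 by (rule normed_space_over.intro)
  interpret E2: normed_space_over v smul N2 using av vs n2 by (rule normed_space_over.intro)
  obtain c where c: "0 < v c" "v c < 1" using valued_field_obtain_small[OF vf] .
  then have c0: "c \<noteq> 0" using av unfolding absolute_value_def by (metis less_irrefl)
  have f0: "f 0 = 0" using lin(1)[of 0 0] by simp
  have "\<exists>d>0. \<forall>x. N1 (0 - x) < d \<longrightarrow> N2 (f 0 - f x) < 1"
    using cont E1.metric_continuous_map[OF E2.Metric_space_axioms]
    unfolding E1.mtopology_of_norm_metric E2.mtopology_of_norm_metric
    by (metis UNIV_I zero_less_one)
  then obtain d where d: "d > 0" "\<And>x. N1 x < d \<Longrightarrow> N2 (f x) < 1"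
    by (auto simp: f0)
  have vpow: "v (c ^ n) = v c ^ n" for n
  proof (induction n)
    case 0
    have "v c * v 1 = v c" using av by (metis absolute_value_def mult.right_neutral)
    then show ?case using c by simp
  next
    case (Suc n)
    then show ?case using av by (simp add: absolute_value_def)
  qed
  have vinv: "v (inverse c) = inverse (v c)"
  proof -
    have "v c * v (inverse c) = v 1" using av c0 by (metis absolute_value_def right_inverse)
    also have "v 1 = 1" using vpow[of 0] by simp
    finally show ?thesis using c by (simp add: inverse_unique)
  qed
  \<comment> \<open>On the shell between \<open>d * v c\<close> and \<open>d\<close> the norm is
    bounded below, so the bound 1 on \<open>f\<close> is already a linear one. The ratio of the
    radii is \<open>v c\<close>, hence scaling by powers of \<open>c\<close> brings every nonzero
    vector into the shell.\<close>
  have small: "N2 (f x) \<le> inverse (d * v c) * N1 x" if x: "d * v c \<le> N1 x" "N1 x < d" for x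
  proof -
    have "1 \<le> inverse (d * v c) * N1 x" using x c d by (simp add: field_simps)
    then show ?thesis using d(2)[OF x(2)] by linarith
  qed
  have down: "N2 (f x) \<le> K * N1 x" if "N2 (f (smul (c ^ n) x)) \<le> K * N1 (smul (c ^ n) x)" for n x K
    using that c by (simp add: lin E1.N_smul E2.N_smul vpow mult.left_commute)
  have bound: "N2 (f x) \<le> inverse (d * v c) * N1 x" for x
  proof (cases "x = 0")
    case True
    then show ?thesis by (simp add: f0)
  next
    case False
    then have pos: "N1 x > 0" by (simp add: order_less_le)
    have vc1: "1 < inverse (v c)" using c by (simp add: one_less_inverse)
    obtain m where m: "d * v c \<le> inverse (v c) ^ m * N1 x"
    proof -
      obtain m where "d * v c / N1 x < inverse (v c) ^ m"
        using real_arch_pow[OF vc1] by blast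
      then show ?thesis using pos that[of m] by (simp add: field_simps)
    qed
    \<comment> \<open>Enlarging \<open>x\<close> beforehand places it on or outside the inner
      radius, from where nonnegative powers of \<open>c\<close> suffice to reach the shell.\<close>
    define y where "y = smul (inverse c ^ m) x"
    have xy: "x = smul (c ^ m) y"
      using c0 by (simp add: y_def flip: power_mult_distrib)
    have vinvpow: "v (inverse c ^ m) = inverse (v c) ^ m"
    proof (induction m)
      case 0
      then show ?case using vpow[of 0] by simp
    next
      case (Suc m)
      then show ?case using av vinv by (simp add: absolute_value_def)
    qed
    have y: "d * v c \<le> N1 y" using m by (simp add: y_def E1.N_smul vinvpow)
    have ex: "\<exists>n. N1 (smul (c ^ n) y) < d"
    proof -
      have "(\<lambda>n. v c ^ n * N1 y) \<longlonglongrightarrow> 0 * N1 y"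
        using c by (intro tendsto_intros LIMSEQ_realpow_zero) auto
      then have "\<forall>\<^sub>F n in sequentially. v c ^ n * N1 y < d"
        using d(1) by (auto dest: order_tendstoD)
      then show ?thesis by (auto simp: E1.N_smul vpow eventually_sequentially)
    qed
    \<comment> \<open>Minimality prevents the shell from being skipped: the preceding multiple still
      has norm at least \<open>d\<close>, and one more factor \<open>c\<close> costs only
      \<open>v c\<close>.\<close>
    define n where "n = (LEAST n. N1 (smul (c ^ n) y) < d)"
    have n: "N1 (smul (c ^ n) y) < d" unfolding n_def using ex by (rule LeastI_ex)
    have "d * v c \<le> N1 (smul (c ^ n) y)"
    proof (cases n)
      case 0
      then show ?thesis using y by simp
    next
      case (Suc k)
      then have "d \<le> N1 (smul (c ^ k) y)"
        using not_less_Least[of k "\<lambda>n. N1 (smul (c ^ n) y) < d"] by (simp add: n_def)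
      then have "d * v c \<le> N1 (smul (c ^ k) y) * v c" using c by simp
      also have "\<dots> = N1 (smul (c ^ n) y)"
        by (simp add: Suc E1.N_smul vpow del: power_Suc) (simp add: mult_ac)
      finally show ?thesis .
    qed
    then have "N2 (f y) \<le> inverse (d * v c) * N1 y"
      using n by (intro down[OF small])
    then have "v c ^ m * N2 (f y) \<le> v c ^ m * (inverse (d * v c) * N1 y)"
      using c by (intro mult_left_mono) auto
    then show ?thesis by (simp add: xy lin E1.N_smul E2.N_smul vpow mult_ac)
  qed
  show thesis using bound d c by (intro that[of "inverse (d * v c)"]) auto
qed

text \<open>Completeness belongs to the norm rather than to its topology. The identity is linear and
  continuous from \<open>N2\<close> to \<open>N1\<close>, hence bounded, so \<open>N2\<close>-Cauchy
  sequences are \<open>N1\<close>-Cauchy; limits agree because the topologies do. This carries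
  completeness from the given norm to the adapted one.\<close>

lemma mcomplete_of_equivalent_norm:
  assumes vf: "valued_field v" and vs: "vector_space smul"
    and n1: "norm_over v smul N1" and n2: "norm_over v smul N2"
    and eq: "mtopology_of (norm_metric N1) = mtopology_of (norm_metric N2)"
    and comp: "mcomplete_of (norm_metric N1)"
  shows "mcomplete_of (norm_metric N2)"
proof -
  have av: "absolute_value v" using vf by (simp add: valued_field_def)
  interpret E1: normed_space_over v smul N1 using av vs n1 by (rule normed_space_over.intro)
  interpret E2: normed_space_over v smul N2 using av vs n2 by (rule normed_space_over.intro)
  have "continuous_map (mtopology_of (norm_metric N2)) (mtopology_of (norm_metric N1)) (\<lambda>x. x)"
    using eq continuous_map_id by (simp add: id_def)
  then obtain K where K: "0 \<le> K" "\<And>x. N1 x \<le> K * N2 x"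
    using linear_continuous_imp_bounded[OF vf vs n2 n1] by metis
  have "E1.MCauchy \<sigma>" if "E2.MCauchy \<sigma>" for \<sigma>
    unfolding E1.MCauchy_def
  proof (intro conjI allI impI)
    fix \<epsilon> assume "\<epsilon> > (0::real)"
    then have "\<epsilon> / (K + 1) > 0" using K by simp
    then obtain M where M: "\<And>n n'. M \<le> n \<Longrightarrow> M \<le> n' \<Longrightarrow> N2 (\<sigma> n - \<sigma> n') < \<epsilon> / (K + 1)"
      using \<open>E2.MCauchy \<sigma>\<close> unfolding E2.MCauchy_def by meson
    have "N1 (\<sigma> n - \<sigma> n') < \<epsilon>" if "M \<le> n" "M \<le> n'" for n n'
    proof -
      have "N1 (\<sigma> n - \<sigma> n') \<le> (K + 1) * N2 (\<sigma> n - \<sigma> n')"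
        using K(2)[of "\<sigma> n - \<sigma> n'"] by (simp add: distrib_right add_increasing2)
      also have "\<dots> < \<epsilon>" using M[OF that] K by (simp add: field_simps)
      finally show ?thesis .
    qed
    then show "\<exists>M. \<forall>n n'. M \<le> n \<longrightarrow> M \<le> n' \<longrightarrow> N1 (\<sigma> n - \<sigma> n') < \<epsilon>" by blast
  qed simp
  then show ?thesis
    using comp eq
    unfolding E1.mcomplete_of_norm_metric E2.mcomplete_of_norm_metric E1.mcomplete_def
      E2.mcomplete_def E1.mtopology_of_norm_metric E2.mtopology_of_norm_metric
    by metis
qed

section \<open>Hyperbolic splittings\<close>

text \<open>\<open>P\<close> is the projection onto the stable subspace along the unstable one, \<open>B\<close> is the inverse
  of \<open>A\<close>.\<close>

locale hyperbolic_splitting = normed_space_over v smul N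
  for v :: "'k::field \<Rightarrow> real"
    and smul :: "'k \<Rightarrow> 'e::ab_group_add \<Rightarrow> 'e"
    and N :: "'e \<Rightarrow> real" +
  fixes A B P :: "'e \<Rightarrow> 'e" and a1 a2 a c :: real
  assumes complete: mcomplete
    and A_add: "A (x + y) = A x + A y"
    and A_B [simp]: "A (B x) = x" and B_A [simp]: "B (A x) = x"
    and P_add: "P (x + y) = P x + P y"
    and P_P [simp]: "P (P x) = P x"
    and P_A: "P (A x) = A (P x)"
    and N_eq_max: "N x = max (N (P x)) (N (x - P x))"
    and N_A_P: "N (A (P x)) \<le> a1 * N (P x)"
    and N_B_Q: "N (B (x - P x)) \<le> a2 * N (x - P x)"
    and N_A: "N (A x) \<le> a * N x"
    and N_B: "N (B x) \<le> c * N x"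
    and nonneg: "0 \<le> a1" "0 \<le> a2" "0 \<le> a" "0 \<le> c"
begin

definition Q :: "'e \<Rightarrow> 'e"
  where "Q x = x - P x"

lemma A_diff: "A (x - y) = A x - A y"
  by (rule additive.diff) (simp add: Modules.additive_def A_add)

lemma P_diff: "P (x - y) = P x - P y"
  by (rule additive.diff) (simp add: Modules.additive_def P_add)

lemma B_add: "B (x + y) = B x + B y"
  by (metis A_add A_B B_A)

lemma B_diff: "B (x - y) = B x - B y"
  by (rule additive.diff) (simp add: Modules.additive_def B_add)

lemma P_B: "P (B x) = B (P x)"
  by (metis A_B B_A P_A)

lemma Q_add: "Q (x + y) = Q x + Q y"
  by (simp add: Q_def P_add)

lemma Q_diff: "Q (x - y) = Q x - Q y"
  by (simp add: Q_def P_diff)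

lemma P_Q [simp]: "P (Q x) = 0" and Q_P [simp]: "Q (P x) = 0" and Q_Q [simp]: "Q (Q x) = Q x"
  by (simp_all add: Q_def P_diff)

lemma Q_A: "Q (A x) = A (Q x)"
  by (simp add: Q_def P_A A_diff)

lemma Q_B: "Q (B x) = B (Q x)"
  by (simp add: Q_def P_B B_diff)

lemma P_plus_Q: "P x + Q x = x"
  by (simp add: Q_def)

lemma A_zero [simp]: "A 0 = 0" and B_zero [simp]: "B 0 = 0"
  using A_diff[of 0 0] B_diff[of 0 0] by simp_all

lemma N_P_le: "N (P x) \<le> N x" and N_Q_le: "N (Q x) \<le> N x"
  using N_eq_max[of x] by (simp_all add: Q_def)

lemma N_le_I: "N (P x) \<le> C \<Longrightarrow> N (Q x) \<le> C \<Longrightarrow> N x \<le> C"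
  using N_eq_max[of x] by (simp add: Q_def)

lemma N_A_P_le: "N (A (P x)) \<le> a1 * N x"
  using N_A_P[of x] mult_left_mono[OF N_P_le nonneg(1)] by (rule order_trans)

lemma N_B_Q_le: "N (B (Q x)) \<le> a2 * N x"
  using N_B_Q[of x] mult_left_mono[OF N_Q_le nonneg(2)] unfolding Q_def by (rule order_trans)

lemma cont_A: "cont A" and cont_B: "cont B" and cont_P: "cont P" and cont_Q: "cont Q"
  using N_A N_B N_P_le N_Q_le nonneg
  by (auto intro: cont_Lipschitz[of a] cont_Lipschitz[of c] cont_Lipschitz[of 1]
      simp flip: A_diff B_diff P_diff Q_diff)

text \<open>The relation is read in two directions: forwards through \<open>A\<close> on the stable
  part, and solved for \<open>e\<close> through \<open>B\<close> on the unstable part. In the second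
  reading the error \<open>p\<close> falls under the factor \<open>a2\<close> too.\<close>

lemma step_bounds:
  assumes "e' = A e + p"
  shows "N (P e') \<le> a1 * N e + N p" and "N (Q e) \<le> a2 * (N e' + N p)"
proof -
  have "P e' = A (P e) + P p" by (simp add: assms P_add P_A)
  then show "N (P e') \<le> a1 * N e + N p"
    using N_triangle[of "A (P e)" "P p"] N_A_P_le[of e] N_P_le[of p] by simp
  have "Q e = B (Q (e' - p))" by (simp add: assms Q_A)
  then have "N (Q e) \<le> a2 * N (e' - p)"
    using N_B_Q_le[of "e' - p"] by simp
  also have "\<dots> \<le> a2 * (N e' + N p)"
    using nonneg N_triangle_diff by (intro mult_left_mono) auto
  finally show "N (Q e) \<le> a2 * (N e' + N p)" .
qed

end

section \<open>Functional equations with a small Lipschitz perturbation\<close>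

locale hyperbolic_perturbation = hyperbolic_splitting v smul N A B P a1 a2 a c
  for v :: "'k::field \<Rightarrow> real"
    and smul :: "'k \<Rightarrow> 'e::ab_group_add \<Rightarrow> 'e"
    and N :: "'e \<Rightarrow> real" and A B P :: "'e \<Rightarrow> 'e" and a1 a2 a c :: real +
  fixes \<delta> :: real
  assumes \<delta>_nonneg: "0 \<le> \<delta>" and a1_\<delta>: "a1 + \<delta> < 1" and a2_\<delta>: "a2 * (1 + \<delta>) < 1"
    and c_pos: "0 < c" and \<delta>_c: "\<delta> < inverse c"
begin

text \<open>For solutions at distance at most M, with perturbation terms at distance at most
  \<delta>M, the forward reading gives (\<open>a1\<close> + \<delta>)M on the stable part and the
  backward one \<open>a2\<close>(M + \<delta>M) on the unstable part.\<close>

definition \<kappa> :: real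
  where "\<kappa> = max (a1 + \<delta>) (a2 * (1 + \<delta>))"

lemma \<kappa>_nonneg: "0 \<le> \<kappa>" and \<kappa>_less_1: "\<kappa> < 1"
  and a1_le_\<kappa>: "a1 + \<delta> \<le> \<kappa>" and a2_le_\<kappa>: "a2 * (1 + \<delta>) \<le> \<kappa>"
  using nonneg \<delta>_nonneg a1_\<delta> a2_\<delta> by (auto simp: \<kappa>_def)

lemma a2_le: "a2 \<le> a2 * (1 + \<delta>)"
  using nonneg \<delta>_nonneg by (simp add: distrib_left)

lemma a2_le_1: "a2 \<le> 1"
  using a2_le a2_\<delta> by simp

abbreviation \<Omega> :: "('e \<Rightarrow> 'e) set"
  where "\<Omega> \<equiv> small_lipschitz_maps N \<delta>"

lemmas \<Omega>D = small_lipschitz_mapsD[OF _ \<delta>_nonneg]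

lemma \<Omega>_BC: "g \<in> \<Omega> \<Longrightarrow> g \<in> BC"
  using small_lipschitz_maps_subset[OF av vs no] by blast

text \<open>Both the equation for \<open>v\<^sub>g\<close> and the one for \<open>w\<^sub>g\<close>, as well as those showing that
  \<open>id + v\<^sub>g\<close> and \<open>id + w\<^sub>g\<close> are inverse to each other, have the form
  \<open>u (G x) = A (u x) + \<Phi> x (u x)\<close> with \<open>G\<close> bijective and \<open>\<Phi> x\<close> Lipschitz with constant \<open>\<delta>\<close>. The
  stable component is determined by following the equation forwards, the unstable one backwards.\<close>

lemma solution_dist:
  assumes G: "\<And>y. G (H y) = y"
    and u1: "u1 \<in> BC" "\<And>x. u1 (G x) = A (u1 x) + \<Phi>1 x (u1 x)"
    and u2: "u2 \<in> BC" "\<And>x. u2 (G x) = A (u2 x) + \<Phi>2 x (u2 x)"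
    and \<Phi>: "\<And>x z z'. N (\<Phi>1 x z - \<Phi>2 x z') \<le> \<delta> * N (z - z') + D"
    and D: "0 \<le> D"
  shows "N (u1 x - u2 x) \<le> D / (1 - \<kappa>)"
proof -
  define e where "e x = u1 x - u2 x" for x
  define p where "p x = \<Phi>1 x (u1 x) - \<Phi>2 x (u2 x)" for x
  have e: "e (G x) = A (e x) + p x" for x
    by (simp add: e_def p_def u1 u2 A_diff)
  obtain C where C: "\<And>x. N (e x) \<le> C"
    unfolding e_def using BC_bounded[OF BC_diff[OF u1(1) u2(1)]] by metis
  \<comment> \<open>\<open>D / (1 - \<kappa>)\<close> is the fixed point of t -> \<kappa>t + D, so
    the excess of the distance over it shrinks by the factor \<kappa> at each improvement.\<close>
  have "N (e x) - D / (1 - \<kappa>) \<le> 0"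
  proof (rule nonpos_of_contracting_bounds[where f = "\<lambda>x. N (e x) - D / (1 - \<kappa>)"])
    show "N (e x) - D / (1 - \<kappa>) \<le> C" for x
      using C[of x] D \<kappa>_less_1 by (smt (verit) divide_nonneg_nonneg)
    fix M x assume M: "0 \<le> (M::real)" "\<And>y. N (e y) - D / (1 - \<kappa>) \<le> M"
    define M' where "M' = D / (1 - \<kappa>) + M"
    have M': "N (e y) \<le> M'" for y using M(2)[of y] by (simp add: M'_def)
    have M'0: "0 \<le> M'" using M' N_nonneg order_trans by blast
    have p: "N (p y) \<le> \<delta> * M' + D" for y
    proof -
      have "N (p y) \<le> \<delta> * N (e y) + D" using \<Phi> by (simp add: p_def e_def)
      also have "\<dots> \<le> \<delta> * M' + D" using M' \<delta>_nonneg by (simp add: mult_left_mono)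
      finally show ?thesis .
    qed
    have "N (P (e x)) \<le> \<kappa> * M' + D"
    proof -
      have "N (P (e x)) \<le> a1 * N (e (H x)) + N (p (H x))"
        using step_bounds(1)[OF e, of "H x"] by (simp add: G)
      also have "\<dots> \<le> a1 * M' + (\<delta> * M' + D)"
        using M' p nonneg by (intro add_mono mult_left_mono) auto
      also have "\<dots> = (a1 + \<delta>) * M' + D" by (simp add: algebra_simps)
      also have "\<dots> \<le> \<kappa> * M' + D"
        using a1_le_\<kappa> M'0 by (simp add: mult_right_mono)
      finally show ?thesis .
    qed
    moreover have "N (Q (e x)) \<le> \<kappa> * M' + D"
    proof -
      have "N (Q (e x)) \<le> a2 * (N (e (G x)) + N (p x))"
        by (rule step_bounds(2)[OF e])
      also have "\<dots> \<le> a2 * (M' + (\<delta> * M' + D))"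
        using M' p nonneg by (intro add_mono mult_left_mono) auto
      also have "\<dots> = a2 * (1 + \<delta>) * M' + a2 * D" by (simp add: algebra_simps)
      also have "\<dots> \<le> \<kappa> * M' + D"
        using a2_le_\<kappa> a2_le_1 M'0 D by (intro add_mono mult_right_mono mult_left_le_one_le nonneg)
      finally show ?thesis .
    qed
    ultimately have "N (e x) \<le> \<kappa> * M' + D" by (rule N_le_I)
    also have "\<dots> = D / (1 - \<kappa>) + \<kappa> * M"
      using \<kappa>_less_1 by (simp add: M'_def field_simps)
    finally show "N (e x) - D / (1 - \<kappa>) \<le> \<kappa> * M" by simp
  qed (use \<kappa>_nonneg \<kappa>_less_1 in auto)
  then show ?thesis by (simp add: e_def)
qed

text \<open>The operator \<open>T\<close> prescribes the stable part of \<open>u\<close> at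
  \<open>y\<close> by the equation at the preimage \<open>H y\<close>, and the unstable part by
  solving the equation at \<open>y\<close> for \<open>u y\<close> with \<open>B\<close>. In this
  form both parts contract, and the fixed point of \<open>T\<close> in BC(E,E) is a
  solution.\<close>

lemma solution_exists:
  assumes G: "cont G" "cont H" "\<And>y. G (H y) = y" "\<And>x. H (G x) = x"
    and \<Phi>_cont: "\<And>u. cont u \<Longrightarrow> cont (\<lambda>x. \<Phi> x (u x))"
    and \<Phi>_bdd: "\<And>x z. N (\<Phi> x z) \<le> D"
    and \<Phi>_lip: "\<And>x z z'. N (\<Phi> x z - \<Phi> x z') \<le> \<delta> * N (z - z')"
  obtains u where "u \<in> BC" "\<And>x. u (G x) = A (u x) + \<Phi> x (u x)"
proof -
  define T where "T u y = A (P (u (H y))) + P (\<Phi> (H y) (u (H y))) + B (Q (u (G y) - \<Phi> y (u y)))"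
    for u y
  have T_BC: "T u \<in> BC" if "u \<in> BC" for u
  proof -
    obtain C where C: "\<And>x. N (u x) \<le> C" using BC_bounded[OF \<open>u \<in> BC\<close>] by blast
    have cu: "cont u" using that by (rule BC_cont)
    have c\<Phi>: "cont (\<lambda>x. \<Phi> x (u x))" by (rule \<Phi>_cont[OF cu])
    show ?thesis
    proof (rule BC_I)
      show "N (T u y) \<le> a1 * C + D + a2 * (C + D)" for y
      proof -
        have "N (T u y) \<le> N (A (P (u (H y)))) + N (P (\<Phi> (H y) (u (H y))))
            + N (B (Q (u (G y) - \<Phi> y (u y))))"
          unfolding T_def by (meson N_triangle add_right_mono order_trans)
        also have "\<dots> \<le> a1 * N (u (H y)) + N (\<Phi> (H y) (u (H y)))
            + a2 * N (u (G y) - \<Phi> y (u y))"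
          by (intro add_mono N_A_P_le N_P_le N_B_Q_le)
        also have "\<dots> \<le> a1 * C + D + a2 * (C + D)"
          using C \<Phi>_bdd nonneg order_trans[OF N_triangle_diff add_mono[OF C \<Phi>_bdd]]
          by (intro add_mono mult_left_mono) auto
        finally show ?thesis .
      qed
      show "cont (T u)"
        unfolding T_def
        by (intro cont_add cont_comp[OF cont_A] cont_comp[OF cont_P] cont_comp[OF cont_B]
            cont_comp[OF cont_Q] cont_diff cont_comp[OF cu] cont_comp[OF c\<Phi>] G c\<Phi>)
    qed
  qed
  have contr: "mdist (bc_space N) (T u) (T u') \<le> \<kappa> * mdist (bc_space N) u u'"
    if u: "u \<in> BC" "u' \<in> BC" for u u'
  proof (rule mdist_BC_le[OF T_BC[OF u(1)] T_BC[OF u(2)]])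
    fix y
    let ?d = "mdist (bc_space N) u u'"
    have d: "N (u x - u' x) \<le> ?d" for x by (rule N_le_mdist_BC[OF u])
    then have d0: "0 \<le> ?d" using N_nonneg order_trans by blast
    define p where "p x = \<Phi> x (u x) - \<Phi> x (u' x)" for x
    have p: "N (p x) \<le> \<delta> * ?d" for x
      unfolding p_def using \<Phi>_lip d \<delta>_nonneg by (meson mult_left_mono order_trans)
    have "P (T u y - T u' y) = A (P (u (H y) - u' (H y))) + P (p (H y))"
      by (simp add: T_def p_def P_add P_diff A_diff P_A P_B)
    then have "N (P (T u y - T u' y)) \<le> a1 * N (u (H y) - u' (H y)) + N (p (H y))"
      using N_triangle[of "A (P (u (H y) - u' (H y)))" "P (p (H y))"]
        N_A_P_le[of "u (H y) - u' (H y)"] N_P_le[of "p (H y)"] by simp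
    also have "\<dots> \<le> a1 * ?d + \<delta> * ?d"
      using d p nonneg by (intro add_mono mult_left_mono) auto
    also have "\<dots> \<le> \<kappa> * ?d"
      using mult_right_mono[OF a1_le_\<kappa> d0] by (simp add: algebra_simps)
    finally have 1: "N (P (T u y - T u' y)) \<le> \<kappa> * ?d" .
    have "Q (T u y - T u' y) = B (Q ((u (G y) - u' (G y)) - p y))"
      by (simp add: T_def p_def Q_add Q_diff B_diff Q_A Q_B)
    then have "N (Q (T u y - T u' y)) \<le> a2 * N ((u (G y) - u' (G y)) - p y)"
      by (simp add: N_B_Q_le)
    also have "\<dots> \<le> a2 * (N (u (G y) - u' (G y)) + N (p y))"
      using nonneg N_triangle_diff by (intro mult_left_mono) auto
    also have "\<dots> \<le> a2 * (?d + \<delta> * ?d)"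
      using d p nonneg by (intro add_mono mult_left_mono) auto
    also have "\<dots> \<le> \<kappa> * ?d"
      using mult_right_mono[OF a2_le_\<kappa> d0] by (simp add: algebra_simps)
    finally have 2: "N (Q (T u y - T u' y)) \<le> \<kappa> * ?d" .
    show "N (T u y - T u' y) \<le> \<kappa> * ?d" using 1 2 by (rule N_le_I)
  qed
  interpret F: Metric_space BC "mdist (bc_space N)"
    by (rule Metric_space_mspace_mdist)
  have "F.mcomplete"
    using mcomplete_of_bc_space[OF complete] by (simp add: mcomplete_of_def)
  moreover have "(\<lambda>x. 0) \<in> BC" by (rule BC_I[of _ 0]) auto
  ultimately obtain u where u: "u \<in> BC" "T u = u"
    using F.Banach_fixedpoint_thm[of T \<kappa>] contr T_BC \<kappa>_less_1 by blast
  \<comment> \<open>The stable part of the fixed point relation is read at \<open>G x\<close>, where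
    \<open>H\<close> undoes \<open>G\<close>; the unstable part is read at \<open>x\<close>, after
    applying \<open>A\<close>.\<close>
  have "P (u (G x)) = P (A (u x) + \<Phi> x (u x))" for x
  proof -
    have "P (u (G x)) = P (T u (G x))" by (simp only: u(2))
    also have "\<dots> = P (A (u x) + \<Phi> x (u x))" by (simp add: T_def P_add P_A P_B G(4))
    finally show ?thesis .
  qed
  moreover have "Q (u (G x)) = Q (A (u x) + \<Phi> x (u x))" for x
  proof -
    have "Q (u x) = Q (T u x)" by (simp only: u(2))
    also have "\<dots> = B (Q (u (G x) - \<Phi> x (u x)))" by (simp add: T_def Q_add Q_A Q_B)
    finally have "A (Q (u x)) = Q (u (G x) - \<Phi> x (u x))" by simp
    then show ?thesis by (simp add: Q_add Q_A Q_diff)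
  qed
  ultimately have "u (G x) = A (u x) + \<Phi> x (u x)" for x
    by (metis P_plus_Q)
  with u(1) show thesis by (rule that)
qed

text \<open>\<open>A\<close> stretches distances at least by the factor \<open>inverse c\<close> and
  \<open>g\<close> takes back at most \<delta>, which gives injectivity and the Lipschitz bound on
  the inverse. Surjectivity holds because A x + g x = y means x = B (y - g x), a fixed point problem
  with contraction constant \<open>c * \<delta>\<close> < 1.\<close>

lemma perturbation_inverse:
  assumes g: "g \<in> \<Omega>"
  obtains H where "\<And>y. A (H y) + g (H y) = y" "\<And>x. H (A x + g x) = x"
    "\<And>x y. N (H x - H y) \<le> N (x - y) / (inverse c - \<delta>)"
proof -
  let ?G = "\<lambda>x. A x + g x"
  have q: "0 < inverse c - \<delta>" using \<delta>_c by simp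
  have low: "(inverse c - \<delta>) * N (x - y) \<le> N (?G x - ?G y)" for x y
  proof -
    have "N (x - y) \<le> c * N (A x - A y)"
      using N_B[of "A x - A y"] by (simp add: B_diff)
    then have "inverse c * N (x - y) \<le> N (A x - A y)"
      using c_pos by (simp add: field_simps)
    also have "\<dots> = N ((?G x - ?G y) - (g x - g y))" by (simp add: algebra_simps)
    also have "\<dots> \<le> N (?G x - ?G y) + \<delta> * N (x - y)"
      using N_triangle_diff \<Omega>D(2)[OF g] by (meson add_left_mono order_trans)
    finally show ?thesis by (simp add: algebra_simps)
  qed
  have "\<exists>x. ?G x = y" for y
  proof -
    have "N (B (y - g x) - B (y - g x')) \<le> (c * \<delta>) * N (x - x')" for x x'
    proof -
      have "N (B (y - g x) - B (y - g x')) \<le> c * N (g x' - g x)"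
        using N_B[of "(y - g x) - (y - g x')"] by (simp add: B_diff)
      also have "\<dots> \<le> c * (\<delta> * N (x - x'))"
        using nonneg \<Omega>D(2)[OF g, of x' x] by (intro mult_left_mono) (auto simp: commute)
      finally show ?thesis by (simp add: mult.assoc)
    qed
    moreover have "c * \<delta> < 1" using \<delta>_c c_pos by (simp add: field_simps)
    ultimately obtain x where "B (y - g x) = x"
      using Banach_fixedpoint_thm[OF complete, of "\<lambda>x. B (y - g x)" "c * \<delta>"] by auto
    then have "A x = y - g x" by (metis A_B)
    then have "?G x = y" by simp
    then show ?thesis ..
  qed
  then obtain H where H: "\<And>y. ?G (H y) = y" by metis
  show thesis
  proof (rule that[of H])
    show "?G (H y) = y" for y by (rule H)
    show lip: "N (H x - H y) \<le> N (x - y) / (inverse c - \<delta>)" for x y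
      using low[of "H x" "H y"] q by (simp add: H field_simps)
    show "H (?G x) = x" for x
      using low[of "H (?G x)" x] q by (simp add: H mult_le_0_iff)
  qed
qed

lemma cont_perturbation: "g \<in> \<Omega> \<Longrightarrow> cont (\<lambda>x. A x + g x)"
  by (intro cont_add cont_A \<Omega>D(3))

section \<open>The displacement \<open>v\<^sub>g\<close> and its Lipschitz dependence on
  \<open>g\<close>\<close>

lemma conj_eq_iff:
  "(\<lambda>x. A x + g x) \<circ> (\<lambda>x. x + w x) = (\<lambda>x. x + w x) \<circ> A
    \<longleftrightarrow> (\<forall>x. w (A x) = A (w x) + g (x + w x))"
  by (auto simp: fun_eq_iff A_add add.assoc)

lemma conj_solution_exists:
  assumes g: "g \<in> \<Omega>"
  obtains u where "u \<in> BC" "\<And>x. u (A x) = A (u x) + g (x + u x)"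
proof (rule solution_exists[of A B "\<lambda>x z. g (x + z)" \<delta>])
  show "cont (\<lambda>x. g (x + u x))" if "cont u" for u
    using that by (intro cont_comp[OF \<Omega>D(3)[OF g]] cont_add cont_id)
  show "N (g (x + z) - g (x + z')) \<le> \<delta> * N (z - z')" for x z z'
    using \<Omega>D(2)[OF g, of "x + z" "x + z'"] by simp
qed (use that \<Omega>D(1)[OF g] cont_A cont_B in auto)

text \<open>Passing through \<open>g (x + z')\<close> separates the change of the point from the
  change of the perturbation. With \<open>h = g\<close> and \<open>D = 0\<close> this is uniqueness
  of \<open>v\<^sub>g\<close>; in general it is the Lipschitz estimate for \<sigma>.\<close>

lemma conj_solution_dist:
  assumes g: "g \<in> \<Omega>" and D: "\<And>x. N (g x - h x) \<le> D"
    and u: "u \<in> BC" "\<And>x. u (A x) = A (u x) + g (x + u x)"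
    and w: "w \<in> BC" "\<And>x. w (A x) = A (w x) + h (x + w x)"
  shows "N (u x - w x) \<le> D / (1 - \<kappa>)"
proof (rule solution_dist[of A B u "\<lambda>x z. g (x + z)" w "\<lambda>x z. h (x + z)"])
  show "N (g (x + z) - h (x + z')) \<le> \<delta> * N (z - z') + D" for x z z'
    using \<Omega>D(2)[OF g, of "x + z" "x + z'"] D[of "x + z'"]
      N_triangle[of "g (x + z) - g (x + z')" "g (x + z') - h (x + z')"]
    by simp
  show "0 \<le> D" using D N_nonneg order_trans by blast
qed (use u w in auto)

lemma conj_disp:
  assumes g: "g \<in> \<Omega>"
  shows "conj_disp N A g \<in> BC"
    and "conj_disp N A g (A x) = A (conj_disp N A g x) + g (x + conj_disp N A g x)"
proof -
  let ?R = "\<lambda>w. w \<in> BC \<and> (\<forall>x. w (A x) = A (w x) + g (x + w x))"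
  obtain u where u: "?R u" using conj_solution_exists[OF g] by metis
  have "w = u" if "?R w" for w
  proof
    fix x
    have "N (w x - u x) \<le> 0 / (1 - \<kappa>)"
      using that u by (intro conj_solution_dist[OF g, of g]) auto
    then show "w x = u x" by simp
  qed
  with u have "?R (THE w. ?R w)" by (rule theI)
  then show "conj_disp N A g \<in> BC"
    "conj_disp N A g (A x) = A (conj_disp N A g x) + g (x + conj_disp N A g x)"
    unfolding conj_disp_def conj_eq_iff by auto
qed

lemma conj_disp_dist:
  assumes "g \<in> \<Omega>" "h \<in> \<Omega>"
  shows "mdist (bc_space N) (conj_disp N A g) (conj_disp N A h)
    \<le> inverse (1 - \<kappa>) * mdist (bc_space N) g h"
proof (rule mdist_BC_le)
  show "N (conj_disp N A g x - conj_disp N A h x) \<le> inverse (1 - \<kappa>) * mdist (bc_space N) g h" for x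
    using conj_solution_dist[OF assms(1) N_le_mdist_BC[OF \<Omega>_BC \<Omega>_BC, OF assms] conj_disp[OF assms(1)] conj_disp[OF assms(2)]]
    by (simp add: divide_inverse mult.commute)
qed (use assms conj_disp(1) in auto)

section \<open>The inverse displacement \<open>w\<^sub>g\<close> and its Hoelder dependence on
  \<open>g\<close>\<close>

text \<open>A map \<open>w\<close> is obtained from its own equation, so bijectivity of id + v need
  not be known beforehand. Then (id + w) o (id + v) commutes with A and (id + v) o (id + w) commutes
  with A + g; the identity does both, and uniqueness of bounded displacements makes both
  compositions the identity.\<close>

lemma conj_disp_inv:
  assumes g: "g \<in> \<Omega>"
  shows "conj_disp_inv N A g \<in> BC"
    and "conj_disp_inv N A g (A x + g x) = A (conj_disp_inv N A g x) - g x"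
    and "y + conj_disp_inv N A g y + conj_disp N A g (y + conj_disp_inv N A g y) = y"
    and "y + conj_disp N A g y + conj_disp_inv N A g (y + conj_disp N A g y) = y"
proof -
  let ?G = "\<lambda>x. A x + g x"
  let ?v = "conj_disp N A g"
  note v = conj_disp[OF g]
  have cg: "cont g" by (rule \<Omega>D(3)[OF g])
  obtain H where H: "\<And>y. ?G (H y) = y" "\<And>x. H (?G x) = x"
    "\<And>x y. N (H x - H y) \<le> N (x - y) / (inverse c - \<delta>)"
    using perturbation_inverse[OF g] by blast
  have cH: "cont H"
    using H(3) \<delta>_c by (intro cont_Lipschitz[of "inverse (inverse c - \<delta>)"])
      (auto simp: divide_inverse mult.commute)
  obtain w where w: "w \<in> BC" "\<And>x. w (?G x) = A (w x) + - g x"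
  proof (rule solution_exists[of ?G H "\<lambda>x z. - g x" \<delta>])
    show "N (- g x - - g x) \<le> \<delta> * N (z - z')" for x z z'
      using \<delta>_nonneg by simp
  qed (use that H(1,2) cH cg \<Omega>D(1)[OF g] cont_perturbation[OF g] cont_uminus[OF cg] in auto)
  have BC_comp: "(\<lambda>x. f x + k (x + f x)) \<in> BC" if "f \<in> BC" "k \<in> BC" for f k
  proof -
    obtain C D where CD: "\<And>x. N (f x) \<le> C" "\<And>x. N (k x) \<le> D"
      using \<open>f \<in> BC\<close> \<open>k \<in> BC\<close> unfolding BC_iff by blast
    show ?thesis
    proof (rule BC_I)
      show "N (f x + k (x + f x)) \<le> C + D" for x
        using N_triangle[of "f x" "k (x + f x)"] CD(1)[of x] CD(2)[of "x + f x"] by linarith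
      show "cont (\<lambda>x. f x + k (x + f x))"
        by (rule cont_add[OF BC_cont[OF that(1)] cont_comp[OF BC_cont[OF that(2)]
            cont_add[OF cont_id BC_cont[OF that(1)]]]])
    qed
  qed
  have zero: "(\<lambda>x. 0) \<in> BC" by (rule BC_I[of _ 0]) auto
  \<comment> \<open>The displacement of (id + w) o (id + v) solves the homogeneous equation, whose
    only bounded continuous solution is 0.\<close>
  have "N ((?v x + w (x + ?v x)) - 0) \<le> 0 / (1 - \<kappa>)" for x
  proof (rule solution_dist[of A B "\<lambda>x. ?v x + w (x + ?v x)" "\<lambda>_ _. 0" "\<lambda>_. 0" "\<lambda>_ _. 0"])
    fix x
    have "A x + ?v (A x) = ?G (x + ?v x)" by (simp add: v(2) A_add add.assoc)
    then have "w (A x + ?v (A x)) = A (w (x + ?v x)) - g (x + ?v x)" by (simp add: w(2))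
    then show "?v (A x) + w (A x + ?v (A x)) = A (?v x + w (x + ?v x)) + 0"
      by (simp add: v(2) A_add)
  qed (use BC_comp[OF v(1) w(1)] zero \<delta>_nonneg in auto)
  then have wv: "?v x + w (x + ?v x) = 0" for x by simp
  \<comment> \<open>Commuting with A + g is a nonlinear condition on a displacement z, with
    perturbation term \<open>g (x + z) - g x\<close>. It vanishes at z = 0, so 0 is again a solution
    to compare with.\<close>
  have "N ((w x + ?v (x + w x)) - 0) \<le> 0 / (1 - \<kappa>)" for x
  proof (rule solution_dist[of ?G H "\<lambda>x. w x + ?v (x + w x)" "\<lambda>x z. g (x + z) - g x" "\<lambda>_. 0"
        "\<lambda>x z. g (x + z) - g x"])
    fix x
    have "?G x + w (?G x) = A (x + w x)" by (simp add: w(2) A_add)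
    then have vG: "?v (?G x + w (?G x)) = A (?v (x + w x)) + g (x + w x + ?v (x + w x))"
      by (simp only: v(2))
    show "w (?G x) + ?v (?G x + w (?G x))
        = A (w x + ?v (x + w x)) + (g (x + (w x + ?v (x + w x))) - g x)"
      unfolding vG unfolding w(2) A_add by (simp add: algebra_simps)
    show "N (g (x + z) - g x - (g (x + z') - g x)) \<le> \<delta> * N (z - z') + 0" for z z'
      using \<Omega>D(2)[OF g, of "x + z" "x + z'"] by simp
  qed (use BC_comp[OF w(1) v(1)] zero H(1) in auto)
  then have vw: "w x + ?v (x + w x) = 0" for x by simp
  have "inv (\<lambda>y. y + ?v y) = (\<lambda>y. y + w y)"
    using wv vw by (intro inv_equality) (simp_all add: add.assoc)
  then have eq: "conj_disp_inv N A g = w"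
    by (auto simp: conj_disp_inv_def)
  show "conj_disp_inv N A g \<in> BC"
    and "conj_disp_inv N A g (A x + g x) = A (conj_disp_inv N A g x) - g x"
    and "y + conj_disp_inv N A g y + ?v (y + conj_disp_inv N A g y) = y"
    and "y + ?v y + conj_disp_inv N A g (y + ?v y) = y"
    using w wv vw by (simp_all add: eq add.assoc)
qed

text \<open>Suppose all differences of \<open>w\<close> are at most \<epsilon>d^\<alpha> + M, where
  d is the distance of the points. One use of the equation reproduces \<epsilon>d^\<alpha>, by
  \<open>s\<close> on the stable part and by \<open>u\<close> on the unstable part, and replaces M
  by \<kappa>M. The denominators in \<open>s\<close> come from the Lipschitz constant of the inverse
  of A + g, the factor \<open>(a + \<delta>) powr \<alpha>\<close> in \<open>u\<close> from that of
  A + g itself.\<close>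

lemma conj_disp_inv_Holder:
  assumes g: "g \<in> \<Omega>" and \<alpha>: "0 \<le> \<alpha>" "\<alpha> \<le> 1" and \<epsilon>: "0 \<le> \<epsilon>"
    and u: "\<epsilon> * a2 * (a + \<delta>) powr \<alpha> + 2 * a2 * \<delta> \<le> \<epsilon>"
    and s: "\<epsilon> * a1 / (inverse c - \<delta>) powr \<alpha> + max (\<delta> / (inverse c - \<delta>)) (2 * \<delta>) \<le> \<epsilon>"
  shows "N (conj_disp_inv N A g x - conj_disp_inv N A g y) \<le> \<epsilon> * N (x - y) powr \<alpha>"
proof -
  let ?w = "conj_disp_inv N A g"
  let ?G = "\<lambda>x. A x + g x"
  let ?q = "inverse c - \<delta>"
  have q: "0 < ?q" using \<delta>_c by simp
  note w = conj_disp_inv[OF g]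
  obtain H where H: "\<And>y. ?G (H y) = y" "\<And>x. H (?G x) = x" "\<And>x y. N (H x - H y) \<le> N (x - y) / ?q"
    using perturbation_inverse[OF g] by blast
  obtain C where C: "\<And>x. N (?w x) \<le> C" using BC_bounded[OF w(1)] by metis
  \<comment> \<open>For t at most 1 the Lipschitz bound is used with t <= t^\<alpha>; for larger t
    the sup norm bound \<open>2 * \<delta>\<close> is used with t^\<alpha> >= 1. This explains the
    maxima with \<open>2 * \<delta>\<close>.\<close>
  have g_le: "N (g x' - g x) \<le> max l (2 * \<delta>) * t powr \<alpha>"
    if "\<delta> * N (x - x') \<le> l * t" "0 \<le> l" "0 \<le> t" for x x' l t
  proof (cases "t \<le> 1")
    case True
    have "N (g x' - g x) \<le> l * t"
      using \<Omega>D(2)[OF g, of x' x] that(1) by (simp add: commute)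
    also have "t \<le> t powr \<alpha>"
      using powr_mono'[of \<alpha> 1 t] \<alpha> True that(3) by (cases "t = 0") auto
    then have "l * t \<le> max l (2 * \<delta>) * t powr \<alpha>"
      using that by (intro mult_mono) auto
    finally show ?thesis .
  next
    case False
    have "N (g x' - g x) \<le> 2 * \<delta> * 1"
      using N_triangle_diff[of "g x'" "g x"] \<Omega>D(1)[OF g, of x] \<Omega>D(1)[OF g, of x'] by simp
    also have "\<dots> \<le> max l (2 * \<delta>) * t powr \<alpha>"
      using \<delta>_nonneg \<alpha> False by (intro mult_mono ge_one_powr_ge_zero) auto
    finally show ?thesis .
  qed
  define f where "f = (\<lambda>(x, y). N (?w x - ?w y) - \<epsilon> * N (x - y) powr \<alpha>)"
  have "f (x, y) \<le> 0"
  proof (rule nonpos_of_contracting_bounds[where f = f])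
    show "f z \<le> C + C" for z
    proof (cases z)
      case (Pair x y)
      have "0 \<le> \<epsilon> * N (x - y) powr \<alpha>" using \<epsilon> by simp
      then show ?thesis
        using N_triangle_diff[of "?w x" "?w y"] C[of x] C[of y] by (simp add: f_def Pair)
    qed
    fix M and z :: "'e \<times> 'e"
    assume M0: "0 \<le> (M::real)" and fM: "\<And>z. f z \<le> M"
    have M: "N (?w x - ?w y) \<le> \<epsilon> * N (x - y) powr \<alpha> + M" for x y
      using fM[of "(x, y)"] by (simp add: f_def)
    obtain x y where z: "z = (x, y)" by (cases z)
    let ?d = "N (x - y)"
    have step: "?w (?G x) - ?w (?G y) = A (?w x - ?w y) + (g y - g x)" for x y
      by (simp add: w(2) A_diff)
    have "N (P (?w x - ?w y)) \<le> \<epsilon> * ?d powr \<alpha> + \<kappa> * M"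
    proof -
      have Hd: "N (H x - H y) \<le> ?d / ?q" by (rule H(3))
      then have "N (H x - H y) powr \<alpha> \<le> (?d / ?q) powr \<alpha>"
        using \<alpha> by (intro powr_mono2) auto
      also have "\<dots> = ?d powr \<alpha> / ?q powr \<alpha>"
        using q by (simp add: powr_divide)
      finally have 1: "N (H x - H y) powr \<alpha> \<le> ?d powr \<alpha> / ?q powr \<alpha>" .
      have "N (g (H y) - g (H x)) \<le> max (\<delta> / ?q) (2 * \<delta>) * ?d powr \<alpha>"
        using mult_left_mono[OF Hd \<delta>_nonneg] q \<delta>_nonneg by (intro g_le) auto
      moreover have "N (?w (H x) - ?w (H y)) \<le> \<epsilon> * (?d powr \<alpha> / ?q powr \<alpha>) + M"
        using M[of "H x" "H y"] mult_left_mono[OF 1 \<epsilon>] by linarith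
      moreover have "N (P (?w x - ?w y)) \<le> a1 * N (?w (H x) - ?w (H y)) + N (g (H y) - g (H x))"
        using step_bounds(1)[OF step, of "H x" "H y"] by (simp add: H)
      ultimately have "N (P (?w x - ?w y)) \<le> a1 * (\<epsilon> * (?d powr \<alpha> / ?q powr \<alpha>) + M)
          + max (\<delta> / ?q) (2 * \<delta>) * ?d powr \<alpha>"
        using nonneg by (smt (verit) mult_left_mono)
      also have "\<dots> = (\<epsilon> * a1 / ?q powr \<alpha> + max (\<delta> / ?q) (2 * \<delta>)) * ?d powr \<alpha> + a1 * M"
        by (simp add: algebra_simps)
      also have "\<dots> \<le> \<epsilon> * ?d powr \<alpha> + \<kappa> * M"
        using s a1_le_\<kappa> \<delta>_nonneg M0 by (intro add_mono mult_right_mono) auto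
      finally show ?thesis .
    qed
    moreover have "N (Q (?w x - ?w y)) \<le> \<epsilon> * ?d powr \<alpha> + \<kappa> * M"
    proof -
      have "N (?G x - ?G y) = N (A (x - y) + (g x - g y))" by (simp add: A_diff algebra_simps)
      also have "\<dots> \<le> (a + \<delta>) * ?d"
        using N_triangle[of "A (x - y)" "g x - g y"] N_A[of "x - y"] \<Omega>D(2)[OF g, of x y]
        by (simp add: distrib_right)
      finally have "N (?G x - ?G y) powr \<alpha> \<le> ((a + \<delta>) * ?d) powr \<alpha>"
        using \<alpha> by (intro powr_mono2) auto
      also have "\<dots> = (a + \<delta>) powr \<alpha> * ?d powr \<alpha>"
        using nonneg \<delta>_nonneg by (simp add: powr_mult)
      finally have 1: "N (?G x - ?G y) powr \<alpha> \<le> (a + \<delta>) powr \<alpha> * ?d powr \<alpha>" .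
      have "N (g y - g x) \<le> max \<delta> (2 * \<delta>) * ?d powr \<alpha>"
        using \<delta>_nonneg by (intro g_le) auto
      then have "N (g y - g x) \<le> 2 * \<delta> * ?d powr \<alpha>"
        using \<delta>_nonneg by (simp add: max_def)
      moreover have "N (?w (?G x) - ?w (?G y)) \<le> \<epsilon> * ((a + \<delta>) powr \<alpha> * ?d powr \<alpha>) + M"
        using M[of "?G x" "?G y"] mult_left_mono[OF 1 \<epsilon>] by linarith
      moreover have "N (Q (?w x - ?w y)) \<le> a2 * (N (?w (?G x) - ?w (?G y)) + N (g y - g x))"
        by (rule step_bounds(2)[OF step])
      ultimately have "N (Q (?w x - ?w y))
          \<le> a2 * ((\<epsilon> * ((a + \<delta>) powr \<alpha> * ?d powr \<alpha>) + M) + 2 * \<delta> * ?d powr \<alpha>)"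
        using nonneg by (smt (verit) mult_left_mono)
      also have "\<dots> = (\<epsilon> * a2 * (a + \<delta>) powr \<alpha> + 2 * a2 * \<delta>) * ?d powr \<alpha> + a2 * M"
        by (simp add: algebra_simps)
      also have "\<dots> \<le> \<epsilon> * ?d powr \<alpha> + \<kappa> * M"
        using u a2_le a2_le_\<kappa> M0 by (intro add_mono mult_right_mono) auto
      finally show ?thesis .
    qed
    ultimately have "N (?w x - ?w y) \<le> \<epsilon> * ?d powr \<alpha> + \<kappa> * M"
      by (rule N_le_I)
    then show "f z \<le> \<kappa> * M"
      by (simp add: f_def z)
  qed (use \<kappa>_nonneg \<kappa>_less_1 in auto)
  then show ?thesis by (simp add: f_def)
qed

text \<open>If \<open>y = x + v\<^sub>h x\<close> and \<open>y' = x + v\<^sub>g x\<close>, then \<open>w\<^sub>h y = x - y\<close> and \<open>w\<^sub>g y' = x - y'\<close>, so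
  that \<open>w\<^sub>g y - w\<^sub>h y = (w\<^sub>g y - w\<^sub>g y') + (y - y')\<close>.\<close>

lemma conj_disp_inv_dist:
  assumes g: "g \<in> \<Omega>" and h: "h \<in> \<Omega>" and \<alpha>: "0 < \<alpha>" "\<alpha> < 1" and \<epsilon>: "0 \<le> \<epsilon>"
    and u: "\<epsilon> * a2 * (a + \<delta>) powr \<alpha> + 2 * a2 * \<delta> \<le> \<epsilon>"
    and s: "\<epsilon> * a1 / (inverse c - \<delta>) powr \<alpha> + max (\<delta> / (inverse c - \<delta>)) (2 * \<delta>) \<le> \<epsilon>"
  shows "mdist (bc_space N) (conj_disp_inv N A g) (conj_disp_inv N A h)
    \<le> (\<epsilon> * inverse (1 - \<kappa>) powr \<alpha> + inverse (1 - \<kappa>) * (2 * \<delta>) powr (1 - \<alpha>))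
      * mdist (bc_space N) g h powr \<alpha>" (is "_ \<le> ?L * _")
proof (rule mdist_BC_le)
  fix y
  let ?t = "mdist (bc_space N) g h"
  let ?C = "inverse (1 - \<kappa>)"
  let ?wg = "conj_disp_inv N A g" and ?wh = "conj_disp_inv N A h"
  define x where "x = y + ?wh y"
  define y' where "y' = x + conj_disp N A g x"
  have C: "0 < ?C" using \<kappa>_less_1 by simp
  have t: "0 \<le> ?t" by simp
  have t2: "?t \<le> 2 * \<delta>"
  proof (rule mdist_BC_le[OF \<Omega>_BC[OF g] \<Omega>_BC[OF h]])
    show "N (g x - h x) \<le> 2 * \<delta>" for x
      using N_triangle_diff[of "g x" "h x"] \<Omega>D(1)[OF g, of x] \<Omega>D(1)[OF h, of x] by simp
  qed
  have wh: "?wh y = x - y" by (simp add: x_def)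
  have y: "x + conj_disp N A h x = y"
    using conj_disp_inv(3)[OF h, of y] by (simp add: x_def)
  have wg: "?wg y' = x - y'"
    using conj_disp_inv(4)[OF g, of x] unfolding y'_def[symmetric] by (metis add_diff_cancel_left')
  have "N (y - y') = N (conj_disp N A g x - conj_disp N A h x)"
    unfolding y'_def y[symmetric] by (simp add: commute)
  also have "\<dots> \<le> ?C * ?t"
    using N_le_mdist_BC[OF conj_disp(1)[OF g] conj_disp(1)[OF h]] conj_disp_dist[OF g h]
    by (rule order_trans)
  finally have yy': "N (y - y') \<le> ?C * ?t" .
  have "N (?wg y - ?wh y) = N ((?wg y - ?wg y') + (y - y'))"
    by (simp add: wg wh algebra_simps)
  also have "\<dots> \<le> \<epsilon> * N (y - y') powr \<alpha> + N (y - y')"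
    using N_triangle[of "?wg y - ?wg y'" "y - y'"] conj_disp_inv_Holder[OF g _ _ \<epsilon> u s, of y y'] \<alpha>
    by simp
  also have "\<dots> \<le> \<epsilon> * (?C powr \<alpha> * ?t powr \<alpha>) + ?C * ((2 * \<delta>) powr (1 - \<alpha>) * ?t powr \<alpha>)"
  proof (rule add_mono)
    have "N (y - y') powr \<alpha> \<le> (?C * ?t) powr \<alpha>"
      using yy' \<alpha> by (intro powr_mono2) auto
    also have "\<dots> = ?C powr \<alpha> * ?t powr \<alpha>"
      by (rule powr_mult)
    finally show "\<epsilon> * N (y - y') powr \<alpha> \<le> \<epsilon> * (?C powr \<alpha> * ?t powr \<alpha>)"
      using \<epsilon> by (rule mult_left_mono)
    \<comment> \<open>Since distances in \<Omega> are at most \<open>2 * \<delta>\<close>, the term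
      linear in \<open>?t\<close> is absorbed into \<open>?t powr \<alpha>\<close>; this yields the
      second summand of \<open>?L\<close>. The first comes from the Hoelder bound on
      \<open>w\<^sub>g\<close> at distance at most \<open>?C * ?t\<close>.\<close>
    have "?t = ?t powr (1 - \<alpha>) * ?t powr \<alpha>"
      using t by (cases "?t = 0") (auto simp flip: powr_add)
    also have "\<dots> \<le> (2 * \<delta>) powr (1 - \<alpha>) * ?t powr \<alpha>"
      using t t2 \<alpha> by (intro mult_right_mono powr_mono2) auto
    finally have "?C * ?t \<le> ?C * ((2 * \<delta>) powr (1 - \<alpha>) * ?t powr \<alpha>)"
      using C by (intro mult_left_mono) auto
    with yy' show "N (y - y') \<le> ?C * ((2 * \<delta>) powr (1 - \<alpha>) * ?t powr \<alpha>)" by linarith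
  qed
  also have "\<dots> = ?L * ?t powr \<alpha>" by (simp add: algebra_simps)
  finally show "N (?wg y - ?wh y) \<le> ?L * ?t powr \<alpha>" .
qed (use conj_disp_inv(1) g h in auto)

end

section \<open>Adapted norms\<close>

context normed_space_over
begin

text \<open>The supremum \<open>op_norm\<close> bounds the quotients only if they are bounded at
  all, which the auxiliary \<open>K\<close> guarantees. In the proof \<open>max K 0\<close> also
  covers the vector 0, whose quotient is 0.\<close>

lemma op_norm_bound:
  assumes "\<And>x. x \<in> S \<Longrightarrow> N (f x) \<le> K * N x" "x \<in> S" "f 0 = 0"
  shows "N (f x) \<le> op_norm N S f * N x"
proof (cases "x = 0")
  case False
  then have pos: "N x > 0" by (simp add: order_less_le)
  have "N (f x) / N x \<le> max K 0" if "x \<in> S" for x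
    using assms(1)[OF that] by (cases "x = 0") (auto simp: divide_le_eq order_less_le le_max_iff_disj)
  then have "bdd_above ((\<lambda>x. N (f x) / N x) ` S)" by (auto simp: bdd_above_def)
  then have "N (f x) / N x \<le> op_norm N S f"
    unfolding op_norm_def using assms(2) by (rule cSUP_upper[rotated])
  then show ?thesis using pos by (simp add: divide_le_eq)
qed (simp add: assms)

lemma op_norm_nonneg:
  assumes "\<And>x. x \<in> S \<Longrightarrow> N (f x) \<le> K * N x" "0 \<in> S"
  shows "0 \<le> op_norm N S f"
proof -
  have "N (f x) / N x \<le> max K 0" if "x \<in> S" for x
    using assms(1)[OF that] by (cases "x = 0") (auto simp: divide_le_eq order_less_le le_max_iff_disj)
  then have "bdd_above ((\<lambda>x. N (f x) / N x) ` S)" by (auto simp: bdd_above_def)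
  then have "N (f 0) / N 0 \<le> op_norm N S f"
    unfolding op_norm_def using assms(2) by (rule cSUP_upper[rotated])
  then show ?thesis by simp
qed

end

text \<open>Topological data become numerical here: continuity of \<open>A\<close> and of its
  inverse makes the operator norms genuine bounds, equality of topologies transfers completeness,
  and the direct sum supplies the projection.\<close>

lemma adapted_norm_imp_hyperbolic_perturbation:
  assumes vf: "valued_field v" and ban: "banach_space_over v smul N0"
    and aut: "tvs_automorphism smul (mtopology_of (norm_metric N0)) A"
    and ad: "adapted_norm v smul (mtopology_of (norm_metric N0)) A Es Eu N"
    and \<delta>: "0 \<le> \<delta>" "\<delta> < inverse (op_norm N UNIV (inv A))"
      "op_norm N Eu (inv_into Eu A) * (1 + \<delta>) < 1" "op_norm N Es A + \<delta> < 1"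
  obtains P where "hyperbolic_perturbation v smul N A (inv A) P (op_norm N Es A)
    (op_norm N Eu (inv_into Eu A)) (op_norm N UNIV A) (op_norm N UNIV (inv A)) \<delta>"
proof -
  have av: "absolute_value v" using vf by (simp add: valued_field_def)
  have vs: "vector_space smul" and n0: "norm_over v smul N0" and comp: "mcomplete_of (norm_metric N0)"
    using ban by (auto simp: banach_space_over_def)
  have n: "norm_over v smul N" and top: "mtopology_of (norm_metric N) = mtopology_of (norm_metric N0)"
    and subE: "module.subspace smul Es" "module.subspace smul Eu"
    and AE: "A ` Es \<subseteq> Es" "A ` Eu \<subseteq> Eu" and int: "Es \<inter> Eu = {0}"
    and sum: "\<And>z. \<exists>x\<in>Es. \<exists>y\<in>Eu. z = x + y"
    and N_max: "\<And>x y. x \<in> Es \<Longrightarrow> y \<in> Eu \<Longrightarrow> N (x + y) = max (N x) (N y)"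
    using ad by (auto simp: adapted_norm_def)
  interpret V: vector_space smul by (rule vs)
  interpret normed_space_over v smul N using av vs n by (rule normed_space_over.intro)
  have "mcomplete_of (norm_metric N)"
    using mcomplete_of_equivalent_norm[OF vf vs n0 n top[symmetric] comp] .
  then have complete: mcomplete by (simp add: mcomplete_of_norm_metric)
  have A_add: "A (x + y) = A x + A y" and A_smul: "A (smul k x) = smul k (A x)" for x y k
    using aut by (auto simp: tvs_automorphism_def Vector_Spaces.linear_iff)
  have "homeomorphic_map mtopology mtopology A"
    using aut top by (simp add: tvs_automorphism_def mtopology_of_norm_metric)
  then obtain B where "homeomorphic_maps mtopology mtopology A B"
    using homeomorphic_map_maps by blast
  then have contA: "cont A" and contB: "cont B" and BA: "\<And>x. B (A x) = x" and AB: "\<And>x. A (B x) = x"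
    by (auto simp: homeomorphic_maps_def)
  have invA: "inv A = B" using BA AB by (rule inv_equality)
  have injA: "inj A" by (metis BA injI)
  have B_add: "B (x + y) = B x + B y" for x y by (metis A_add AB BA)
  have B_smul: "B (smul k x) = smul k (B x)" for x k by (metis A_smul AB BA)
  have A0: "A 0 = 0" and B0: "B 0 = 0" using A_add[of 0 0] B_add[of 0 0] by auto
  obtain KA where KA: "\<And>x. N (A x) \<le> KA * N x"
    using linear_continuous_imp_bounded[OF vf vs n n A_add A_smul] contA
    unfolding mtopology_of_norm_metric by metis
  obtain KB where KB: "\<And>x. N (B x) \<le> KB * N x"
    using linear_continuous_imp_bounded[OF vf vs n n B_add B_smul] contB
    unfolding mtopology_of_norm_metric by metis
  obtain P where P: "\<And>z. P z \<in> Es" "\<And>z. z - P z \<in> Eu"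
    using sum by (metis add_diff_cancel_left')
  \<comment> \<open>\<open>P\<close> is merely chosen, but directness of the sum makes the
    decomposition unique; identities for \<open>P\<close> then follow by exhibiting a
    decomposition.\<close>
  have P_eq: "P z = x" if "x \<in> Es" "z - x \<in> Eu" for x z
  proof -
    have "P z - x \<in> Es" using P that subE by (simp add: V.subspace_diff)
    moreover have "(z - x) - (z - P z) \<in> Eu"
      by (rule V.subspace_diff[OF subE(2) that(2) P(2)])
    ultimately have "P z - x \<in> Es \<inter> Eu" by simp
    then show ?thesis using int by simp
  qed
  have A_diff: "A (x - y) = A x - A y" for x y
    by (rule additive.diff) (simp add: Modules.additive_def A_add)
  have P_A: "P (A x) = A (P x)" for x
    using P AE by (intro P_eq) (auto simp flip: A_diff)
  have P_add: "P (x + y) = P x + P y" for x y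
  proof (rule P_eq)
    show "P x + P y \<in> Es" using P subE by (simp add: V.subspace_add)
    have "(x - P x) + (y - P y) \<in> Eu" using P subE by (simp add: V.subspace_add)
    then show "x + y - (P x + P y) \<in> Eu" by (simp add: algebra_simps)
  qed
  \<comment> \<open>Invariance is assumed as an inclusion under \<open>A\<close> only. That the
    inverse preserves \<open>Eu\<close> follows because \<open>P\<close> commutes with the injective
    map \<open>A\<close>.\<close>
  have B_Eu: "B y \<in> Eu" if "y \<in> Eu" for y
  proof -
    have "P y = 0" using that subE by (intro P_eq) (auto simp: V.subspace_0)
    then have "A (P (B y)) = A 0" using P_A[of "B y"] by (simp add: AB A0)
    then have "P (B y) = 0" using injA by (simp add: inj_eq)
    then show ?thesis using P(2)[of "B y"] by simp
  qed
  \<comment> \<open>This identifies the inverse of the restriction \<open>A\<^sub>2\<close> with the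
    restriction of the inverse of \<open>A\<close>.\<close>
  have "inv_into Eu A y = B y" if "y \<in> Eu" for y
    using inv_into_f_f[OF inj_on_subset[OF injA subset_UNIV] B_Eu[OF that]] by (simp add: AB)
  then have inv_Eu: "op_norm N Eu (inv_into Eu A) = op_norm N Eu B"
    by (simp add: op_norm_def)
  have zero: "0 \<in> Es" "0 \<in> Eu" using subE V.subspace_0 by auto
  have "hyperbolic_perturbation v smul N A B P (op_norm N Es A)
    (op_norm N Eu B) (op_norm N UNIV A) (op_norm N UNIV B) \<delta>"
  proof
    show mcomplete by (rule complete)
    show "P (P x) = P x" for x using P zero by (intro P_eq) auto
    show "N x = max (N (P x)) (N (x - P x))" for x
      using N_max[OF P(1)[of x] P(2)[of x]] by simp
    show "N (A (P x)) \<le> op_norm N Es A * N (P x)" for x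
      by (rule op_norm_bound[OF KA P(1) A0])
    show "N (B (x - P x)) \<le> op_norm N Eu B * N (x - P x)" for x
      by (rule op_norm_bound[OF KB P(2) B0])
    show "N (A x) \<le> op_norm N UNIV A * N x" "N (B x) \<le> op_norm N UNIV B * N x" for x
      by (rule op_norm_bound[OF KA UNIV_I A0], rule op_norm_bound[OF KB UNIV_I B0])
    show "0 \<le> op_norm N Es A" "0 \<le> op_norm N Eu B" "0 \<le> op_norm N UNIV A" "0 \<le> op_norm N UNIV B"
      using op_norm_nonneg[OF KA] op_norm_nonneg[OF KB] zero by auto
    show "op_norm N Eu B * (1 + \<delta>) < 1" using \<delta> by (simp add: inv_Eu)
    show "\<delta> < inverse (op_norm N UNIV B)" using \<delta> by (simp add: invA)
    \<comment> \<open>A nonnegative \<delta> strictly below \<open>inverse c\<close> forces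
      \<open>c\<close> to be positive, so the value \<open>inverse 0 = 0\<close> cannot
      occur.\<close>
    then show "0 < op_norm N UNIV B"
      using \<delta>(1) by (metis inverse_positive_iff_positive order_le_less_trans)
  qed (use A_add AB BA P_add P_A \<delta> in auto)
  then show thesis using that by (simp add: inv_Eu invA)
qed

theorem theorem7p6:
  fixes v :: "'k::field \<Rightarrow> real"
    and smul :: "'k \<Rightarrow> 'e::ab_group_add \<Rightarrow> 'e"
    and N0 N :: "'e \<Rightarrow> real"
    and A :: "'e \<Rightarrow> 'e" and Es Eu :: "'e set"
    and \<alpha> \<epsilon> \<delta> :: real
  assumes "valued_field v"
    and "banach_space_over v smul N0"
    and "hyperbolic_automorphism v smul (mtopology_of (norm_metric N0)) A"
    and "adapted_norm v smul (mtopology_of (norm_metric N0)) A Es Eu N"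
    and "0 < \<alpha>" "\<alpha> < 1" "0 < \<epsilon>" "0 < \<delta>"
    and "\<delta> < inverse (op_norm N UNIV (inv A))"
    and "op_norm N Eu (inv_into Eu A) * (1 + \<delta>) < 1"
    and "op_norm N Es A + \<delta> < 1"
    and "2 * op_norm N Eu (inv_into Eu A) * \<delta>
         + \<epsilon> * op_norm N Eu (inv_into Eu A) * (op_norm N UNIV A + \<delta>) powr \<alpha>
         + op_norm N Eu (inv_into Eu A) * max (\<delta> * (1 + \<epsilon>)) (2 * \<delta>) \<le> \<epsilon>"
    and "\<epsilon> * op_norm N Es A / (inverse (op_norm N UNIV (inv A)) - \<delta>) powr \<alpha>
         + max (\<delta> / (inverse (op_norm N UNIV (inv A)) - \<delta>)) (2 * \<delta>)
         + max (\<delta> * (1 + \<epsilon>)) (2 * \<delta>) / (inverse (op_norm N UNIV (inv A)) - \<delta>) powr \<alpha> \<le> \<epsilon>"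
  shows "Lipschitz_continuous_map
           (submetric (bc_space N) (small_lipschitz_maps N \<delta>)) (bc_space N) (conj_disp N A)
       \<and> Holder_map \<alpha>
           (submetric (bc_space N) (small_lipschitz_maps N \<delta>)) (bc_space N) (conj_disp_inv N A)"
proof -
  define a1 where "a1 = op_norm N Es A"
  define a2 where "a2 = op_norm N Eu (inv_into Eu A)"
  define a where "a = op_norm N UNIV A"
  define c where "c = op_norm N UNIV (inv A)"
  note a_defs = a1_def a2_def a_def c_def
  have "tvs_automorphism smul (mtopology_of (norm_metric N0)) A"
    using assms(3) by (simp add: hyperbolic_automorphism_def)
  from adapted_norm_imp_hyperbolic_perturbation[OF assms(1,2) this assms(4) less_imp_le[OF assms(8)]
      assms(9,10,11)]
  obtain P where "hyperbolic_perturbation v smul N A (inv A) P a1 a2 a c \<delta>"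
    unfolding a_defs .
  then interpret hyperbolic_perturbation v smul N A "inv A" P a1 a2 a c \<delta> .
  have m: "0 \<le> max (\<delta> * (1 + \<epsilon>)) (2 * \<delta>)" using assms(8) by simp
  have "0 \<le> a2 * max (\<delta> * (1 + \<epsilon>)) (2 * \<delta>)" using nonneg m by simp
  then have u: "\<epsilon> * a2 * (a + \<delta>) powr \<alpha> + 2 * a2 * \<delta> \<le> \<epsilon>"
    using assms(12) unfolding a_defs by linarith
  have "0 \<le> max (\<delta> * (1 + \<epsilon>)) (2 * \<delta>) / (inverse c - \<delta>) powr \<alpha>" using m by simp
  then have s: "\<epsilon> * a1 / (inverse c - \<delta>) powr \<alpha> + max (\<delta> / (inverse c - \<delta>)) (2 * \<delta>) \<le> \<epsilon>"
    using assms(13) unfolding a_defs by linarith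
  have "Lipschitz_continuous_map (submetric (bc_space N) \<Omega>) (bc_space N) (conj_disp N A)"
    unfolding Lipschitz_continuous_map_def using conj_disp(1) conj_disp_dist by auto
  moreover have "0 \<le> \<epsilon> * inverse (1 - \<kappa>) powr \<alpha> + inverse (1 - \<kappa>) * (2 * \<delta>) powr (1 - \<alpha>)"
    using assms(7) \<kappa>_less_1 by simp
  then have "Holder_map \<alpha> (submetric (bc_space N) \<Omega>) (bc_space N) (conj_disp_inv N A)"
    unfolding Holder_map_def
    using conj_disp_inv(1) conj_disp_inv_dist[OF _ _ assms(5,6) less_imp_le[OF assms(7)] u s]
    by auto
  ultimately show ?thesis ..
qed

end
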